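(* Let $S\subset\mathbb{T}^2$ be compact and suppose no non-zero positive RP-measure on $\mathbb{T}^2$ has support contained in $S$. Then $A_{\vec 0}(\mathbb{D}^2)|_{T(S)}=\{f|_{T(S)}: f\in A_{\vec 0}(\mathbb{D}^2)\}$ is dense in $C(T(S))$ with respect to the supremum norm.
   Context: $T:\mathbb{T}^2\to\mathbb{T}^2$, $T(z_1,z_2)=(z_1,\overline{z_2})$. RP-measures on $\mathbb{T}^2$: real Borel measures $\mu$ of bounded variation on $\mathbb{T}^2$ whose Poisson integral $P[d\mu](z)=\int_{\mathbb{T}^2}\prod_{j=1}^2\frac{1-|z_j|^2}{|\zeta_j-z_j|^2}\,d\mu(\zeta)$ is the real part of a holomorphic function on $\mathbb{D}^2$. $A(\mathbb{D}^2)$ is the bidisc algebra regarded as a subspace of $C(\mathbb{T}^2)$; $A_{\vec 0}(\mathbb{D}^2)=\{z_1z_2 f: f\in A(\mathbb{D}^2)\}$. *)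

theory Defs
  imports "HOL-Analysis.Analysis"
begin

definition torus2 :: "(complex \<times> complex) set" where
  "torus2 = {z. norm (fst z) = 1 \<and> norm (snd z) = 1}"

definition bidisc :: "(complex \<times> complex) set" where
  "bidisc = ball 0 1 \<times> ball 0 1"

definition closed_bidisc :: "(complex \<times> complex) set" where
  "closed_bidisc = cball 0 1 \<times> cball 0 1"

definition Tmap :: "complex \<times> complex \<Rightarrow> complex \<times> complex" where
  "Tmap z = (fst z, cnj (snd z))"

text \<open>Holomorphy in two complex variables: complex (Frechet) differentiability,
  i.e. the derivative is a C-linear map C^2 -> C.\<close>
definition holomorphic2_on ::
  "(complex \<times> complex \<Rightarrow> complex) \<Rightarrow> (complex \<times> complex) set \<Rightarrow> bool" where
  "holomorphic2_on F U \<longleftrightarrow>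
     (\<forall>z\<in>U. \<exists>a b. (F has_derivative (\<lambda>h. a * fst h + b * snd h)) (at z))"

definition poisson2 :: "(complex \<times> complex) measure \<Rightarrow> complex \<times> complex \<Rightarrow> real" where
  "poisson2 M z = (\<integral>\<zeta>. ((1 - (norm (fst z))\<^sup>2) / (norm (fst \<zeta> - fst z))\<^sup>2) *
                        ((1 - (norm (snd z))\<^sup>2) / (norm (snd \<zeta> - snd z))\<^sup>2) \<partial>M)"

definition positive_RP_measure :: "(complex \<times> complex) measure \<Rightarrow> bool" where
  "positive_RP_measure M \<longleftrightarrow>
     sets M = sets borel \<and> finite_measure M \<and> emeasure M (- torus2) = 0 \<and>
     (\<exists>F. holomorphic2_on F bidisc \<and> (\<forall>z\<in>bidisc. poisson2 M z = Re (F z)))"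

definition bidisc_algebra :: "(complex \<times> complex \<Rightarrow> complex) set" where
  "bidisc_algebra = {f. continuous_on closed_bidisc f \<and> holomorphic2_on f bidisc}"

definition bidisc_algebra0 :: "(complex \<times> complex \<Rightarrow> complex) set" where
  "bidisc_algebra0 = {(\<lambda>z. fst z * snd z * f z) | f. f \<in> bidisc_algebra}"

end

theory Submission
  imports Defs "HOL-Probability.Probability"
begin

text \<open>Put \<open>K = T(S)\<close>. A positive measure on \<open>S\<close> is an RP-measure as soon as its image under \<open>T\<close>
  annihilates the monomials \<open>z\<^sub>1\<^sup>m z\<^sub>2\<^sup>n\<close> with \<open>m, n \<ge> 1\<close>. If no polynomial
  \<open>f \<in> A\<^sub>0\<close> had positive real part on \<open>K\<close>, then probability measures on \<open>K\<close> minimising finitely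
  many squared moments would have a weak limit point annihilating all these monomials, against the
  hypothesis. So there is \<open>f \<in> A\<^sub>0\<close> with \<open>Re f > 0\<close> on \<open>K\<close>, and \<open>1 - (1 - c f)\<^sup>n\<close> approximates \<open>1\<close>
  for small \<open>c > 0\<close>. As \<open>A\<^sub>0\<close> is an ideal of the bidisc algebra, the uniform closure of its
  restriction to \<open>K\<close> contains \<open>z\<^sub>1\<close>, \<open>z\<^sub>2\<close> and, because \<open>z\<^sub>1 z\<^sub>2 h \<approx> 1\<close> gives \<open>z\<^sub>2 h \<approx> cnj z\<^sub>1\<close>, also their
  conjugates; Stone-Weierstrass applies.\<close>

section \<open>A finite-dimensional moment alternative\<close>

text \<open>Mixing with a point mass moves moment vectors along a segment, so the moments of
  finitely supported distributions on a set form a convex set.\<close>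

lemma expectation_bernoulli_mixture:
  fixes h :: "'a \<Rightarrow> complex"
  assumes "finite (set_pmf p)" "0 \<le> t" "t \<le> 1"
  shows "measure_pmf.expectation (bernoulli_pmf t \<bind> (\<lambda>b. if b then return_pmf x else p)) h
       = of_real t * h x + of_real (1 - t) * measure_pmf.expectation p h"
  using assms
  by (subst pmf_expectation_bind[where A=UNIV]) (auto simp: UNIV_bool scaleR_conv_of_real split: if_splits)

text \<open>A separation argument: the moment vectors form a convex set at positive distance from
  the origin, so the vector of nearly minimal norm is the normal of a half-space containing every
  vector \<open>e _ x\<close>. The infimum need not be attained, hence quantitative bounds replace
  an exact minimiser.\<close>

lemma finite_moment_alternative:
  fixes e :: "'i \<Rightarrow> 'a \<Rightarrow> complex"
  assumes "finite J" and K: "K \<noteq> {}"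
    and bound: "\<And>i x. i \<in> J \<Longrightarrow> x \<in> K \<Longrightarrow> norm (e i x) \<le> 1"
    and "\<delta> > 0"
    and far: "\<And>p. finite (set_pmf p) \<Longrightarrow> set_pmf p \<subseteq> K \<Longrightarrow>
               \<delta> \<le> (\<Sum>i\<in>J. (norm (measure_pmf.expectation p (e i)))\<^sup>2)"
  shows "\<exists>c. \<forall>x\<in>K. 0 < Re (\<Sum>i\<in>J. c i * e i x)"
proof -
  define \<Phi> where "\<Phi> p = (\<Sum>i\<in>J. (norm (measure_pmf.expectation p (e i)))\<^sup>2)" for p
  define P where "P = {p. finite (set_pmf p) \<and> set_pmf p \<subseteq> K}"
  define I where "I = (INF p\<in>P. \<Phi> p)"
  define W where "W = real (card J)"
  \<comment> \<open>The step size is chosen so that the quadratic cost is at most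
    \<open>t\<^sup>2 * W = t * I / 4\<close>, a quarter of the first-order gain
    \<open>t * I\<close>.\<close>
  define t where "t = I / (4 * W)"
  obtain x0 where x0: "x0 \<in> K" using K by blast
  have ret: "return_pmf x \<in> P" if "x \<in> K" for x using that by (simp add: P_def)
  then have Pne: "P \<noteq> {}" using x0 by blast
  have "\<delta> \<le> I" unfolding I_def using Pne far by (intro cINF_greatest) (auto simp: P_def \<Phi>_def)
  with \<open>\<delta> > 0\<close> have I: "I > 0" by simp
  have bdd: "bdd_below (\<Phi> ` P)" by (rule bdd_belowI[of _ 0]) (auto simp: \<Phi>_def intro: sum_nonneg)
  have I_le: "I \<le> \<Phi> p" if "p \<in> P" for p
    unfolding I_def by (rule cINF_lower[OF bdd that])
  have sq: "(\<Sum>i\<in>J. (norm (e i x))\<^sup>2) \<le> W" if "x \<in> K" for x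
  proof -
    have "(\<Sum>i\<in>J. (norm (e i x))\<^sup>2) \<le> (\<Sum>i\<in>J. 1)"
      using bound[OF _ that] by (intro sum_mono) (simp add: power_le_one)
    then show ?thesis by (simp add: W_def)
  qed
  have "I \<le> W" using I_le[OF ret[OF x0]] sq[OF x0] by (simp add: \<Phi>_def)
  with I have W: "W > 0" by simp
  have t: "0 < t" "t \<le> 1/4" using I W \<open>I \<le> W\<close> by (auto simp: t_def field_simps)
  \<comment> \<open>The slack \<open>t * I\<close> is affordable: shrinking by
    \<open>(1 - t)\<^sup>2\<close> takes \<open>I + t * I\<close> below \<open>I - t * I\<close>, up
    to a further decrease of order \<open>t\<^sup>2\<close>.\<close>
  have "(INF p\<in>P. \<Phi> p) < I + t * I" using I t unfolding I_def[symmetric] by simp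
  then obtain p where p: "p \<in> P" "\<Phi> p < I + t * I"
    using cINF_less_iff[OF Pne bdd] by blast
  \<comment> \<open>With these coefficients, \<open>Re (\<Sum>i\<in>J. c i * e i x)\<close> is the
    real inner product of the moment vectors of \<open>p\<close> and of the point mass at
    \<open>x\<close>.\<close>
  define c where "c i = cnj (measure_pmf.expectation p (e i))" for i
  have "0 < Re (\<Sum>i\<in>J. c i * e i x)" if x: "x \<in> K" for x
  proof -
    \<comment> \<open>Moving from the near-minimiser \<open>p\<close> towards the point mass at \<open>x\<close> cannot push \<open>\<Phi>\<close> below \<open>I\<close>;
      to first order in \<open>t\<close> this forces \<open>R > 0\<close>.\<close>
    define q where "q = bernoulli_pmf t \<bind> (\<lambda>b. if b then return_pmf x else p)"
    define R where "R = Re (\<Sum>i\<in>J. c i * e i x)"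
    have "q \<in> P" using p x t by (auto simp: P_def q_def split: if_splits)
    have Eq: "measure_pmf.expectation q (e i) = of_real t * e i x + of_real (1 - t) * cnj (c i)" for i
      unfolding q_def using p t by (subst expectation_bernoulli_mixture) (auto simp: P_def c_def)
    have "(norm (of_real t * a + of_real (1 - t) * cnj b))\<^sup>2
        = t\<^sup>2 * (norm a)\<^sup>2 + 2 * t * (1 - t) * Re (b * a) + (1 - t)\<^sup>2 * (norm b)\<^sup>2" for a b :: complex
      unfolding cmod_power2 by (simp add: power2_eq_square algebra_simps)
    then have "(norm (measure_pmf.expectation q (e i)))\<^sup>2
        = t\<^sup>2 * (norm (e i x))\<^sup>2 + 2 * t * (1 - t) * Re (c i * e i x) + (1 - t)\<^sup>2 * (norm (c i))\<^sup>2" for i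
      unfolding Eq .
    then have "\<Phi> q = (\<Sum>i\<in>J. t\<^sup>2 * (norm (e i x))\<^sup>2 + 2 * t * (1 - t) * Re (c i * e i x)
        + (1 - t)\<^sup>2 * (norm (c i))\<^sup>2)"
      by (simp only: \<Phi>_def)
    also have "\<dots> = t\<^sup>2 * (\<Sum>i\<in>J. (norm (e i x))\<^sup>2) + 2 * t * (1 - t) * R + (1 - t)\<^sup>2 * \<Phi> p"
      by (simp only: sum.distrib sum_distrib_left[symmetric] R_def Re_sum \<Phi>_def c_def complex_mod_cnj)
    finally have "\<Phi> q = t\<^sup>2 * (\<Sum>i\<in>J. (norm (e i x))\<^sup>2) + 2 * t * (1 - t) * R + (1 - t)\<^sup>2 * \<Phi> p" .
    moreover have "t\<^sup>2 * (\<Sum>i\<in>J. (norm (e i x))\<^sup>2) \<le> t * (I / 4)"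
    proof -
      have "t\<^sup>2 * (\<Sum>i\<in>J. (norm (e i x))\<^sup>2) \<le> t\<^sup>2 * W" by (rule mult_left_mono[OF sq[OF x]]) simp
      also have "\<dots> = t * (I / 4)" using W by (simp add: t_def power2_eq_square)
      finally show ?thesis .
    qed
    moreover have "(1 - t)\<^sup>2 * \<Phi> p \<le> (1 - t)\<^sup>2 * (I + t * I)"
      using p(2) by (intro mult_left_mono) auto
    ultimately have "I - t * (I / 4) - (1 - t)\<^sup>2 * (I + t * I) \<le> 2 * t * (1 - t) * R"
      using I_le[OF \<open>q \<in> P\<close>] by linarith
    moreover have "(1 - t)\<^sup>2 * (I + t * I) = I - t * I - t * t * (I * (1 - t))"
      by (simp add: power2_eq_square algebra_simps)
    moreover have "t * t * (I * (1 - t)) \<ge> 0" "t * I > 0" using t I by auto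
    ultimately have "0 < 2 * t * (1 - t) * R" by (simp add: field_simps)
    moreover have "0 < 2 * t * (1 - t)" using t by simp
    ultimately show ?thesis unfolding R_def by (metis zero_less_mult_pos)
  qed
  then show ?thesis by blast
qed

section \<open>A curve filling the torus\<close>

text \<open>The truncations \<open>u n\<close> of \<open>x\<close> to \<open>n\<close> binary places
  converge to \<open>x\<close>, and their increments are the digits \<open>d n\<close> with weight
  \<open>(1/2) ^ Suc n\<close>, so the series telescopes. The condition \<open>x < 1\<close> makes
  \<open>u 0\<close> vanish.\<close>

lemma binary_expansion:
  fixes x :: real
  assumes "0 \<le> x" "x < 1"
  obtains a :: "nat \<Rightarrow> nat" where "\<And>n. a n \<le> 1" "(\<lambda>n. real (a n) * (1/2) ^ Suc n) sums x"
proof -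
  define d where "d n = \<lfloor>2 ^ Suc n * x\<rfloor> - 2 * \<lfloor>2 ^ n * x\<rfloor>" for n
  have d: "0 \<le> d n" "d n \<le> 1" for n
  proof -
    have *: "2 ^ Suc n * x = 2 * (2 ^ n * x)" by simp
    show "0 \<le> d n" "d n \<le> 1" unfolding d_def * by linarith+
  qed
  define u where "u n = real_of_int \<lfloor>2 ^ n * x\<rfloor> * (1/2) ^ n" for n
  have "u \<longlonglongrightarrow> x"
  proof (rule real_tendsto_sandwich)
    have "(\<lambda>n. x - (1/2) ^ n) \<longlonglongrightarrow> x - 0" by (intro tendsto_intros LIMSEQ_power_zero) auto
    then show "(\<lambda>n. x - (1/2) ^ n) \<longlonglongrightarrow> x" by simp
    have "x - (1/2) ^ n \<le> u n \<and> u n \<le> x" for n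
    proof -
      have "2 ^ n * x - 1 \<le> real_of_int \<lfloor>2 ^ n * x\<rfloor>" "real_of_int \<lfloor>2 ^ n * x\<rfloor> \<le> 2 ^ n * x" by linarith+
      moreover have "(1/2) ^ n * 2 ^ n = (1::real)" by (simp add: power_mult_distrib[symmetric])
      ultimately have "(1/2) ^ n * (2 ^ n * x - 1) \<le> u n" "u n \<le> (1/2) ^ n * (2 ^ n * x)"
        by (simp_all only: u_def mult.commute[of _ "(1/2::real) ^ n"] mult_left_mono zero_le_power
              zero_le_divide_iff zero_le_one zero_le_numeral simp_thms)
      then show ?thesis using \<open>(1/2) ^ n * 2 ^ n = (1::real)\<close>
        by (simp add: right_diff_distrib flip: mult.assoc)
    qed
    then show "\<forall>\<^sub>F n in sequentially. x - (1/2) ^ n \<le> u n" "\<forall>\<^sub>F n in sequentially. u n \<le> x" by auto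
  qed simp
  then have "(\<lambda>n. u (Suc n) - u n) sums (x - u 0)" by (rule telescope_sums)
  moreover have "u 0 = 0" using assms by (simp add: u_def floor_eq_iff)
  moreover have "u (Suc n) - u n = real (nat (d n)) * (1/2) ^ Suc n" for n
    using d(1)[of n] by (simp add: u_def d_def algebra_simps)
  ultimately show ?thesis using d by (intro that[of "\<lambda>n. nat (d n)"]) (auto simp: nat_le_iff)
qed

text \<open>Schoenberg's space-filling curve reads off the ternary digits of its argument with this
  function, which is \<open>2\<close>-periodic, \<open>0\<close> on \<open>[0, 1/3]\<close> and \<open>1\<close> on \<open>[2/3, 1]\<close>.\<close>

definition digit_reader :: "real \<Rightarrow> real" where
  "digit_reader t = max 0 (min 1 (1/2 - cos (pi * t)))"

lemma digit_reader_low: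
  assumes "0 \<le> t" "t \<le> 1/3"
  shows "digit_reader t = 0"
proof -
  have "cos (pi / 3) \<le> cos (pi * t)"
    using assms by (intro cos_monotone_0_pi_le) (auto simp: field_simps)
  then show ?thesis by (simp add: digit_reader_def cos_60)
qed

lemma digit_reader_high:
  assumes "2/3 \<le> t" "t \<le> 1"
  shows "digit_reader t = 1"
proof -
  have "cos (pi / 3) \<le> cos (pi * (1 - t))"
    using assms by (intro cos_monotone_0_pi_le) (auto simp: field_simps)
  also have "cos (pi * (1 - t)) = - cos (pi * t)" by (simp add: right_diff_distrib)
  finally show ?thesis by (simp add: digit_reader_def cos_60)
qed

lemma digit_reader_periodic: "digit_reader (2 * real k + t) = digit_reader t"
proof -
  have "cos (pi * (2 * real k + t)) = cos (pi * t + real k * (2 * pi))" by (simp add: algebra_simps)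
  also have "\<dots> = cos (pi * t)"
    using cos.plus_of_nat[of "pi * t" k] by (simp add: algebra_simps)
  finally show ?thesis by (simp add: digit_reader_def)
qed

text \<open>All ternary digits of \<open>s\<close> are 0 or 2, so in \<open>3 ^ k * s\<close> the
  digits before place \<open>k\<close> add up to an even integer, which the period removes. What
  remains is \<open>2 * a k / 3 + r / 3\<close> with \<open>r\<close> in the unit interval, hence a
  point of the first or of the last third.\<close>

lemma digit_reader_ternary:
  fixes a :: "nat \<Rightarrow> nat"
  assumes a: "\<And>n. a n \<le> 1"
  defines "s \<equiv> (\<Sum>n. 2 * real (a n) * (1/3) ^ Suc n)"
  shows "digit_reader (3 ^ k * s) = real (a k)" "0 \<le> s" "s \<le> 1"
proof -
  have geo: "(\<lambda>n. 2 * (1/3) ^ Suc n :: real) sums 1"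
    using sums_mult[OF geometric_sums[of "1/3::real"], of "2/3"] by simp
  have le: "2 * real (b n) * (1/3) ^ Suc n \<le> 2 * (1/3) ^ Suc n" if "\<And>n. b n \<le> 1" for b :: "nat \<Rightarrow> nat" and n
    using that[of n] by simp
  have summ: "summable (\<lambda>n. 2 * real (b n) * (1/3) ^ Suc n)" if "\<And>n. b n \<le> 1" for b :: "nat \<Rightarrow> nat"
    by (rule summable_comparison_test'[OF sums_summable[OF geo], of 0]) (use le[OF that] in auto)
  have rng: "0 \<le> (\<Sum>n. 2 * real (b n) * (1/3) ^ Suc n)" "(\<Sum>n. 2 * real (b n) * (1/3) ^ Suc n) \<le> 1"
    if "\<And>n. b n \<le> 1" for b :: "nat \<Rightarrow> nat"
  proof -
    show "0 \<le> (\<Sum>n. 2 * real (b n) * (1/3) ^ Suc n)" by (intro suminf_nonneg summ that) auto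
    have "(\<Sum>n. 2 * real (b n) * (1/3) ^ Suc n) \<le> (\<Sum>n. 2 * (1/3) ^ Suc n)"
      by (intro suminf_le summ that le sums_summable[OF geo])
    then show "(\<Sum>n. 2 * real (b n) * (1/3) ^ Suc n) \<le> 1" using sums_unique[OF geo] by simp
  qed
  show "0 \<le> s" "s \<le> 1" unfolding s_def using rng[OF a] by auto
  define r where "r = (\<Sum>n. 2 * real (a (n + Suc k)) * (1/3) ^ Suc n)"
  have r: "0 \<le> r" "r \<le> 1" unfolding r_def using rng[of "\<lambda>n. a (n + Suc k)"] a by auto
  \<comment> \<open>Half of the integer part contributed by the first \<open>k\<close>
    digits.\<close>
  define m where "m = (\<Sum>n<k. a n * 3 ^ (k - Suc n))"
  have "s = (\<Sum>n. 2 * real (a (n + Suc k)) * (1/3) ^ Suc (n + Suc k)) + (\<Sum>n<Suc k. 2 * real (a n) * (1/3) ^ Suc n)"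
    unfolding s_def using suminf_split_initial_segment[OF summ[OF a], where k="Suc k"] by simp
  also have "(\<Sum>n. 2 * real (a (n + Suc k)) * (1/3) ^ Suc (n + Suc k)) = (1/3) ^ Suc k * r"
    unfolding r_def using a
    by (subst suminf_mult[symmetric, OF summ]) (auto simp: power_add mult_ac)
  finally have s_eq: "s = (1/3) ^ Suc k * r + (\<Sum>n<Suc k. 2 * real (a n) * (1/3) ^ Suc n)" .
  have three: "(3::real) ^ k * (1/3) ^ Suc k = 1 / 3" by (simp add: power_divide)
  from s_eq have "3 ^ k * s = r / 3 + 3 ^ k * (\<Sum>n<Suc k. 2 * real (a n) * (1/3) ^ Suc n)"
    using three by (simp only: distrib_left mult.assoc[symmetric])
  also have "(3::real) ^ k * (\<Sum>n<Suc k. 2 * real (a n) * (1/3) ^ Suc n)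
      = 2 * real (a k) / 3 + (\<Sum>n<k. 2 * (real (a n) * (3 ^ k * (1/3) ^ Suc n)))"
    by (simp add: sum_distrib_left algebra_simps power_divide)
  also have "(\<Sum>n<k. 2 * (real (a n) * (3 ^ k * (1/3) ^ Suc n))) = 2 * real m"
  proof -
    have "(3::real) ^ k * (1/3) ^ Suc n = 3 ^ (k - Suc n)" if "n < k" for n
      using that power_add[of "3::real" "k - Suc n" "Suc n"] by (simp add: power_divide)
    then show ?thesis unfolding m_def of_nat_sum sum_distrib_left by (intro sum.cong) auto
  qed
  finally have eq: "3 ^ k * s = 2 * real m + (2 * real (a k) / 3 + r / 3)" by simp
  consider "a k = 0" | "a k = 1" using a[of k] by linarith
  then show "digit_reader (3 ^ k * s) = real (a k)"
    unfolding eq digit_reader_periodic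
    by cases (use r in \<open>auto simp: digit_reader_low digit_reader_high\<close>)
qed

lemma continuous_on_digit_reader [continuous_intros]:
  fixes A :: "'a::t2_space set"
  shows "continuous_on A f \<Longrightarrow> continuous_on A (\<lambda>x. digit_reader (f x))"
  unfolding digit_reader_def by (intro continuous_intros)

text \<open>The two coordinates of Schoenberg's curve are the cases \<open>j = 0\<close> and
  \<open>j = 1\<close>, reading even and odd ternary places. The M-test gives uniform convergence on
  the whole line, which carries continuity over to the sum.\<close>

lemma continuous_on_schoenberg:
  "continuous_on UNIV (\<lambda>t. \<Sum>n. digit_reader (3 ^ (2 * n + j) * t) * (1/2) ^ Suc n)"
proof (rule uniform_limit_theorem)
  have "summable (\<lambda>n. (1/2::real) ^ Suc n)" by (simp add: summable_geometric)
  moreover have "norm (digit_reader u * (1/2) ^ Suc n) \<le> (1/2) ^ Suc n" for u n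
    by (auto simp: digit_reader_def abs_mult)
  ultimately show "uniform_limit UNIV (\<lambda>N t. \<Sum>n<N. digit_reader (3 ^ (2 * n + j) * t) * (1/2) ^ Suc n)
      (\<lambda>t. \<Sum>n. digit_reader (3 ^ (2 * n + j) * t) * (1/2) ^ Suc n) sequentially"
    by (intro Weierstrass_m_test)
qed (auto intro!: always_eventually continuous_intros)

text \<open>To hit \<open>(x, y)\<close>, interleave the binary digits of both coordinates, double
  them, and read the result as a ternary expansion of the parameter. The half-open square is what
  the angles on a circle range over.\<close>

lemma space_filling_curve:
  obtains \<gamma> :: "real \<Rightarrow> real \<times> real"
  where "continuous_on UNIV \<gamma>" "{0..<1} \<times> {0..<1} \<subseteq> \<gamma> ` {0..1}"
proof -
  define f where "f j t = (\<Sum>n. digit_reader (3 ^ (2 * n + j) * t) * (1/2) ^ Suc n)" for j :: nat and t :: real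
  have "(x, y) \<in> (\<lambda>t. (f 0 t, f 1 t)) ` {0..1}" if "x \<in> {0..<1}" "y \<in> {0..<1}" for x y
  proof -
    have x01: "0 \<le> x" "x < 1" and y01: "0 \<le> y" "y < 1" using that by auto
    obtain a where a: "\<And>n. a n \<le> 1" "(\<lambda>n. real (a n) * (1/2) ^ Suc n) sums x"
      using binary_expansion[OF x01] by blast
    obtain b where b: "\<And>n. b n \<le> 1" "(\<lambda>n. real (b n) * (1/2) ^ Suc n) sums y"
      using binary_expansion[OF y01] by blast
    define c where "c n = (if even n then a (n div 2) else b (n div 2))" for n
    have c: "c n \<le> 1" for n using a b by (simp add: c_def)
    define t where "t = (\<Sum>n. 2 * real (c n) * (1/3) ^ Suc n)"
    have digit: "digit_reader (3 ^ k * t) = real (c k)" and "t \<in> {0..1}" for k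
      unfolding t_def using digit_reader_ternary[OF c] by auto
    moreover have "f 0 t = x" "f 1 t = y"
      unfolding f_def digit using a(2) b(2) by (simp_all add: c_def sums_iff)
    ultimately show ?thesis by force
  qed
  moreover have "continuous_on UNIV (f j)" for j
    unfolding f_def by (rule continuous_on_schoenberg)
  ultimately show ?thesis
    by (intro that[of "\<lambda>t. (f 0 t, f 1 t)"] continuous_on_Pair) auto
qed

text \<open>Its purpose is to transfer weak compactness from the real line to the torus: measures on
  the torus become images of measures on the unit interval.\<close>

lemma torus_filling_curve:
  obtains \<psi> :: "real \<Rightarrow> complex \<times> complex"
  where "continuous_on UNIV \<psi>" "range \<psi> \<subseteq> torus2" "torus2 \<subseteq> \<psi> ` {0..1}"
proof -
  obtain \<gamma> :: "real \<Rightarrow> real \<times> real"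
    where \<gamma>: "continuous_on UNIV \<gamma>" "{0..<1} \<times> {0..<1} \<subseteq> \<gamma> ` {0..1}"
    by (rule space_filling_curve)
  define E where "E = (\<lambda>(x, y). (cis (2 * pi * x), cis (2 * pi * y)))"
  have circle: "\<exists>x\<in>{0..<1}. z = cis (2 * pi * x)" if "norm z = 1" for z
  proof -
    have "z = cis (Arg2pi z)" using that Arg2pi_eq[of z] by (simp add: cis_conv_exp)
    moreover have "Arg2pi z / (2 * pi) \<in> {0..<1}" using Arg2pi_ge_0 Arg2pi_lt_2pi by auto
    ultimately show ?thesis by (metis nonzero_mult_div_cancel_left times_divide_eq_right pi_neq_zero mult_eq_0_iff zero_neq_numeral)
  qed
  show ?thesis
  proof (rule that[of "E \<circ> \<gamma>"])
    have "continuous_on UNIV E"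
      unfolding E_def case_prod_unfold by (intro continuous_intros)
    then show "continuous_on UNIV (E \<circ> \<gamma>)"
      using \<gamma>(1) by (metis continuous_on_compose continuous_on_subset subset_UNIV)
    show "range (E \<circ> \<gamma>) \<subseteq> torus2" by (auto simp: E_def torus2_def split: prod.split)
    show "torus2 \<subseteq> (E \<circ> \<gamma>) ` {0..1}"
    proof
      fix z assume "z \<in> torus2"
      then obtain x y where "x \<in> {0..<1}" "y \<in> {0..<1}" "z = E (x, y)"
        using circle[of "fst z"] circle[of "snd z"] by (auto simp: torus2_def E_def prod_eq_iff)
      moreover then have "(x, y) \<in> \<gamma> ` {0..1}" using \<gamma>(2) by blast
      ultimately show "z \<in> (E \<circ> \<gamma>) ` {0..1}" by auto
    qed
  qed
qed

section \<open>Weak compactness\<close>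

text \<open>Lift each \<open>p n\<close> to the unit interval through a right inverse of the
  torus-filling curve, extract a weakly convergent subsequence there by tightness, and push the
  limit forward along the curve.\<close>

lemma weak_limit_of_pmfs_on_torus:
  fixes p :: "nat \<Rightarrow> (complex \<times> complex) pmf"
  assumes K: "K \<subseteq> torus2" "compact K" and p: "\<And>n. set_pmf (p n) \<subseteq> K"
  obtains r M where "strict_mono (r :: nat \<Rightarrow> nat)" "prob_space M" "sets M = sets borel" "emeasure M (- K) = 0"
    "\<And>f :: complex \<times> complex \<Rightarrow> complex. continuous_on UNIV f \<Longrightarrow>
       (\<lambda>n. measure_pmf.expectation (p (r n)) f) \<longlonglongrightarrow> (\<integral>x. f x \<partial>M)"
proof -
  obtain \<psi> :: "real \<Rightarrow> complex \<times> complex"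
    where \<psi>: "continuous_on UNIV \<psi>" "range \<psi> \<subseteq> torus2" "torus2 \<subseteq> \<psi> ` {0..1}"
    by (rule torus_filling_curve)
  have [measurable]: "\<psi> \<in> borel_measurable borel"
    using \<psi>(1) by (rule borel_measurable_continuous_onI)
  \<comment> \<open>An arbitrary choice of preimages. It may be discontinuous, but every map is
    measurable on the discrete sigma-algebra of a pmf, and only \<psi> acts on the limit
    measure.\<close>
  define \<sigma> where "\<sigma> z = (SOME t. t \<in> {0..1} \<and> \<psi> t = z)" for z
  have \<sigma>: "\<sigma> z \<in> {0..1}" "\<psi> (\<sigma> z) = z" if "z \<in> torus2" for z
  proof -
    have "\<exists>t. t \<in> {0..1} \<and> \<psi> t = z" using that \<psi>(3) by blast
    from someI_ex[OF this] show "\<sigma> z \<in> {0..1}" "\<psi> (\<sigma> z) = z" by (auto simp: \<sigma>_def)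
  qed
  define \<mu> where "\<mu> n = distr (measure_pmf (p n)) borel \<sigma>" for n
  have rd: "real_distribution (\<mu> n)" for n
    unfolding \<mu>_def by (rule prob_space.real_distribution_distr[OF prob_space_measure_pmf]) simp
  \<comment> \<open>Tightness is phrased with intervals open on the left, so the lower end lies
    below 0 to keep the parameter 0 inside.\<close>
  have "measure (\<mu> n) {-1<..1} = 1" for n
  proof -
    have "measure (\<mu> n) {-1<..1} = measure_pmf.prob (p n) (\<sigma> -` {-1<..1})"
      by (simp add: \<mu>_def measure_distr)
    also have "\<dots> = 1"
      using p[of n] K(1) \<sigma>(1) by (subst measure_pmf.prob_eq_1) (fastforce simp: AE_measure_pmf_iff)+
    finally show ?thesis .
  qed
  then have "tight \<mu>"
    unfolding tight_def using rd by (intro conjI allI impI exI[of _ "-1"] exI[of _ 1]) auto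
  from tight_imp_convergent_subsubsequence[OF this strict_mono_id]
  obtain r \<nu> where r: "strict_mono r" "real_distribution \<nu>" "weak_conv_m (\<mu> \<circ> r) \<nu>"
    by auto
  interpret \<nu>: real_distribution \<nu> by fact
  define M where "M = distr \<nu> borel \<psi>"
  interpret M: prob_space M
    unfolding M_def by (rule \<nu>.prob_space_distr) simp
  have conv: "(\<lambda>n. measure_pmf.expectation (p (r n)) f) \<longlonglongrightarrow> (\<integral>x. f x \<partial>M)" and int: "integrable M f"
    if f: "continuous_on UNIV f" for f :: "complex \<times> complex \<Rightarrow> complex"
  proof -
    have meas[measurable]: "f \<in> borel_measurable borel" using f by (rule borel_measurable_continuous_onI)
    \<comment> \<open>Compactness of the torus bounds \<open>f\<close> on the range of \<psi>, so
      \<open>f \<circ> \<psi>\<close> is a bounded continuous test function.\<close>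
    have "torus2 = \<psi> ` {0..1}" using \<psi> by auto
    moreover have "compact (\<psi> ` {0..1})"
      using \<psi>(1) by (intro compact_continuous_image) (auto intro: continuous_on_subset)
    ultimately have "bounded (f ` torus2)"
      using f by (intro compact_imp_bounded compact_continuous_image) (auto intro: continuous_on_subset)
    then obtain B where "\<And>z. z \<in> torus2 \<Longrightarrow> norm (f z) \<le> B" by (auto simp: bounded_iff)
    then have B: "norm (f (\<psi> t)) \<le> B" for t using \<psi>(2) by blast
    have "continuous_on UNIV (f \<circ> \<psi>)"
      using f \<psi>(1) by (metis continuous_on_compose continuous_on_subset subset_UNIV)
    then have "(\<lambda>n. \<integral>t. f (\<psi> t) \<partial>(\<mu> \<circ> r) n) \<longlonglongrightarrow> (\<integral>t. f (\<psi> t) \<partial>\<nu>)"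
      using r rd B
      by (intro weak_conv_imp_integral_bdd_continuous_conv[where B=B])
         (auto simp: continuous_on_eq_continuous_at o_def)
    moreover have "(\<integral>t. f (\<psi> t) \<partial>(\<mu> \<circ> r) n) = measure_pmf.expectation (p (r n)) f" for n
    proof -
      have "(\<integral>t. f (\<psi> t) \<partial>(\<mu> \<circ> r) n) = measure_pmf.expectation (p (r n)) (\<lambda>z. f (\<psi> (\<sigma> z)))"
        by (simp add: \<mu>_def integral_distr)
      also have "\<dots> = measure_pmf.expectation (p (r n)) f"
        using p[of "r n"] K(1) \<sigma>(2) by (intro integral_cong_AE) (fastforce simp: AE_measure_pmf_iff)+
      finally show ?thesis .
    qed
    moreover have "(\<integral>t. f (\<psi> t) \<partial>\<nu>) = (\<integral>x. f x \<partial>M)"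
      by (simp add: M_def integral_distr)
    ultimately show "(\<lambda>n. measure_pmf.expectation (p (r n)) f) \<longlonglongrightarrow> (\<integral>x. f x \<partial>M)" by simp
    have "integrable \<nu> (\<lambda>t. f (\<psi> t))"
      using B by (intro \<nu>.integrable_const_bound[where B=B]) auto
    then show "integrable M f" by (simp add: M_def integrable_distr_eq)
  qed
  have "emeasure M (- K) = 0"
  proof -
    have "K \<noteq> {}" using p[of 0] set_pmf_not_empty[of "p 0"] by blast
    \<comment> \<open>The distance to \<open>K\<close> is a continuous test function that vanishes
      under each \<open>p n\<close>. Its integral under \<open>M\<close> is therefore 0, and
      nonnegativity places almost every point in \<open>K\<close>.\<close>
    define f where "f z = complex_of_real (infdist z K)" for z
    have f: "continuous_on UNIV f" unfolding f_def by (intro continuous_intros)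
    have "measure_pmf.expectation (p n) f = measure_pmf.expectation (p n) (\<lambda>_. 0)" for n
      using p[of n] by (intro integral_cong_AE) (auto simp: AE_measure_pmf_iff f_def)
    then have "(\<integral>z. f z \<partial>M) = 0" using conv[OF f] by (simp add: LIMSEQ_const_iff)
    then have "(\<integral>z. infdist z K \<partial>M) = 0" by (simp add: f_def)
    moreover have "integrable M (\<lambda>z. infdist z K)"
      using integrable_Re[OF int[OF f]] by (simp add: f_def)
    ultimately have "AE z in M. infdist z K = 0"
      by (subst (asm) integral_nonneg_eq_0_iff_AE) (auto simp: infdist_nonneg)
    then have "AE z in M. z \<in> K"
      by (rule eventually_mono)
         (simp add: in_closed_iff_infdist_zero[OF compact_imp_closed[OF K(2)] \<open>K \<noteq> {}\<close>])
    then show ?thesis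
      using K(2) by (subst (asm) AE_iff_measurable[where N="- K"])
        (auto simp: M_def compact_imp_closed)
  qed
  with r(1) conv show ?thesis
    by (intro that[of r M]) (auto simp: M_def M.prob_space_axioms[unfolded M_def])
qed

section \<open>Vanishing mixed moments and RP-measures\<close>

text \<open>For \<open>\<zeta>\<close> on the unit circle this is the Cauchy kernel
  \<open>\<zeta> / (\<zeta> - z)\<close>. The form with \<open>cnj\<close> exhibits it as the
  geometric series in \<open>z * cnj \<zeta>\<close>.\<close>

definition cauchy_kernel :: "complex \<Rightarrow> complex \<Rightarrow> complex" where
  "cauchy_kernel z \<zeta> = 1 / (1 - z * cnj \<zeta>)"

lemma cauchy_kernel_bound:
  assumes "norm \<zeta> = 1" "norm z \<le> r" "r < 1"
  shows "z * cnj \<zeta> \<noteq> 1" "norm (cauchy_kernel z \<zeta>) \<le> 1 / (1 - r)"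
proof -
  have "1 - r \<le> norm (1 - z * cnj \<zeta>)"
    using norm_triangle_ineq2[of 1 "z * cnj \<zeta>"] assms by (simp add: norm_mult)
  then show "z * cnj \<zeta> \<noteq> 1" "norm (cauchy_kernel z \<zeta>) \<le> 1 / (1 - r)"
    using assms by (auto simp: cauchy_kernel_def norm_divide intro!: divide_left_mono mult_pos_pos)
qed

text \<open>A resolvent identity. Inserted into itself it gives a first-order expansion in
  \<open>h\<close> with an explicit quadratic remainder.\<close>

lemma cauchy_kernel_diff:
  assumes "z * cnj \<zeta> \<noteq> 1" "(z + h) * cnj \<zeta> \<noteq> 1"
  shows "cauchy_kernel (z + h) \<zeta> - cauchy_kernel z \<zeta>
      = h * cnj \<zeta> * cauchy_kernel z \<zeta> * cauchy_kernel (z + h) \<zeta>"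
proof -
  have "1 - z * cnj \<zeta> \<noteq> 0" "1 - (z + h) * cnj \<zeta> \<noteq> 0" using assms by auto
  then show ?thesis unfolding cauchy_kernel_def by (simp add: field_simps)
qed

lemma cauchy_kernel_measurable [measurable]: "cauchy_kernel z \<in> borel_measurable borel"
proof -
  have [measurable]: "cnj \<in> borel_measurable borel"
    by (intro borel_measurable_continuous_onI continuous_intros)
  show ?thesis unfolding cauchy_kernel_def[abs_def] by measurable
qed

text \<open>Put \<open>u = 1 - z * cnj \<zeta>\<close>. Then
  \<open>norm (\<zeta> - z) = norm u\<close> and
  \<open>1 - z * cnj z = u + cnj u - u * cnj u\<close>; dividing by \<open>u * cnj u\<close> gives
  the claim.\<close>

lemma poisson_kernel_conv_cauchy_kernel:
  assumes "norm \<zeta> = 1" "norm z < 1"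
  shows "complex_of_real ((1 - (norm z)\<^sup>2) / (norm (\<zeta> - z))\<^sup>2)
       = cauchy_kernel z \<zeta> + cnj (cauchy_kernel z \<zeta>) - 1"
proof -
  have ne: "1 - z * cnj \<zeta> \<noteq> 0" using cauchy_kernel_bound(1)[OF assms(1) order_refl assms(2)] by auto
  then have ne': "1 - cnj z * \<zeta> \<noteq> 0" by (metis complex_cnj_cnj complex_cnj_diff complex_cnj_mult complex_cnj_one complex_cnj_zero)
  have \<zeta>: "\<zeta> * cnj \<zeta> = 1" using assms(1) by (simp add: complex_norm_square[symmetric])
  have "norm (\<zeta> - z) = norm ((\<zeta> - z) * cnj \<zeta>)" using assms(1) by (simp add: norm_mult)
  also have "(\<zeta> - z) * cnj \<zeta> = 1 - z * cnj \<zeta>" using \<zeta> by (simp add: left_diff_distrib)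
  finally have "complex_of_real ((1 - (norm z)\<^sup>2) / (norm (\<zeta> - z))\<^sup>2)
      = (1 - z * cnj z) / ((1 - z * cnj \<zeta>) * (1 - cnj z * \<zeta>))"
    by (simp add: complex_norm_square del: of_real_power)
  also have "1 - z * cnj z = (1 - cnj z * \<zeta>) + (1 - z * cnj \<zeta>) - (1 - z * cnj \<zeta>) * (1 - cnj z * \<zeta>)"
    using \<zeta> by (simp add: algebra_simps)
  also have "\<dots> / ((1 - z * cnj \<zeta>) * (1 - cnj z * \<zeta>)) = cauchy_kernel z \<zeta> + cnj (cauchy_kernel z \<zeta>) - 1"
  proof -
    have "(v + u - u * v) / (u * v) = 1 / u + 1 / v - 1" if "u \<noteq> 0" "v \<noteq> 0" for u v :: complex
      using that by (simp add: field_simps)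
    from this[OF ne ne'] show ?thesis by (simp add: cauchy_kernel_def)
  qed
  finally show ?thesis .
qed

locale torus_prob = prob_space M for M :: "(complex \<times> complex) measure" +
  assumes sets_M [measurable_cong]: "sets M = sets borel"
    and null_M: "emeasure M (- torus2) = 0"
begin

lemma AE_torus: "AE \<zeta> in M. norm (fst \<zeta>) = 1 \<and> norm (snd \<zeta>) = 1"
proof (rule AE_I)
  have "closed torus2"
    unfolding torus2_def by (intro closed_Collect_conj closed_Collect_eq continuous_intros)
  then show "- torus2 \<in> sets M" by (simp add: sets_M)
  show "emeasure M (- torus2) = 0" by (rule null_M)
qed (auto simp: torus2_def)

lemma fst_measurable [measurable]: "fst \<in> borel_measurable M"
  and snd_measurable [measurable]: "snd \<in> borel_measurable M"
  unfolding measurable_cong_sets[OF sets_M refl]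
  by (intro borel_measurable_continuous_onI continuous_intros)+

lemma integrable_bounded_on_torus:
  fixes f :: "complex \<times> complex \<Rightarrow> complex"
  assumes [measurable]: "f \<in> borel_measurable M"
    and f: "\<And>\<zeta>. norm (fst \<zeta>) = 1 \<Longrightarrow> norm (snd \<zeta>) = 1 \<Longrightarrow> norm (f \<zeta>) \<le> B"
  shows "integrable M f" "norm (\<integral>\<zeta>. f \<zeta> \<partial>M) \<le> B"
proof -
  have ae: "AE \<zeta> in M. norm (f \<zeta>) \<le> B" using AE_torus by eventually_elim (simp add: f)
  then show int: "integrable M f" by (rule integrable_const_bound) simp
  have "norm (\<integral>\<zeta>. f \<zeta> \<partial>M) \<le> (\<integral>\<zeta>. norm (f \<zeta>) \<partial>M)" by simp
  also have "\<dots> \<le> (\<integral>\<zeta>. B \<partial>M)" using int ae by (intro integral_mono_AE) auto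
  finally show "norm (\<integral>\<zeta>. f \<zeta> \<partial>M) \<le> B" by (simp add: prob_space)
qed

text \<open>Differentiation under the integral: the product kernel has a first-order expansion at
  \<open>z\<close> whose remainder is quadratic in \<open>y - z\<close>, uniformly over the torus,
  and this bound survives integration.\<close>

lemma holomorphic2_cauchy_integral:
  "holomorphic2_on (\<lambda>z. \<integral>\<zeta>. cauchy_kernel (fst z) (fst \<zeta>) * cauchy_kernel (snd z) (snd \<zeta>) \<partial>M) bidisc"
  unfolding holomorphic2_on_def
proof
  fix z :: "complex \<times> complex" assume "z \<in> bidisc"
  define r where "r = max (norm (fst z)) (norm (snd z))"
  have r: "norm (fst z) \<le> r" "norm (snd z) \<le> r" "r < 1"
    using \<open>z \<in> bidisc\<close> by (auto simp: r_def bidisc_def)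
  \<comment> \<open>Half the distance to the boundary: on coordinates of modulus at most
    \<open>r + e\<close> the denominators have modulus at least \<open>1 - (r + e) = e\<close>, so
    the kernels are bounded by \<open>D\<close>.\<close>
  define e where "e = (1 - r) / 2"
  define D where "D = 1 / e"
  have e: "0 < e" "r + e < 1" "D \<ge> 0" using r by (auto simp: e_def D_def field_simps)
  have ker: "norm (cauchy_kernel x \<zeta>) \<le> D" "x * cnj \<zeta> \<noteq> 1" if "norm \<zeta> = 1" "norm x \<le> r + e" for x \<zeta>
  proof -
    have *: "1 - (r + e) = e" by (simp add: e_def field_simps)
    show "norm (cauchy_kernel x \<zeta>) \<le> D"
      using cauchy_kernel_bound(2)[OF that e(2)] unfolding D_def * .
    show "x * cnj \<zeta> \<noteq> 1" using that e(2) by (rule cauchy_kernel_bound(1))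
  qed
  define c where "c y \<zeta> = cauchy_kernel (fst y) (fst \<zeta>)" for y \<zeta> :: "complex \<times> complex"
  define d where "d y \<zeta> = cauchy_kernel (snd y) (snd \<zeta>)" for y \<zeta> :: "complex \<times> complex"
  \<comment> \<open>\<open>\<alpha>\<close> and \<open>\<beta>\<close> are the two complex partial
    derivatives of the product kernel at \<open>z\<close>; a single kernel has derivative
    \<open>cnj \<zeta> * (cauchy_kernel z \<zeta>)\<^sup>2\<close>.\<close>
  define \<alpha> where "\<alpha> \<zeta> = cnj (fst \<zeta>) * (c z \<zeta>)\<^sup>2 * d z \<zeta>" for \<zeta>
  define \<beta> where "\<beta> \<zeta> = cnj (snd \<zeta>) * c z \<zeta> * (d z \<zeta>)\<^sup>2" for \<zeta>
  have [measurable]: "c y \<in> borel_measurable M" "d y \<in> borel_measurable M" for y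
    unfolding c_def d_def by measurable
  have [measurable]: "cnj \<in> borel_measurable borel"
    by (intro borel_measurable_continuous_onI continuous_intros)
  have [measurable]: "\<alpha> \<in> borel_measurable M" "\<beta> \<in> borel_measurable M"
    unfolding \<alpha>_def \<beta>_def by measurable
  have zb: "norm (c z \<zeta>) \<le> D" "norm (d z \<zeta>) \<le> D" if "norm (fst \<zeta>) = 1" "norm (snd \<zeta>) = 1" for \<zeta>
    using ker[OF that(1), of "fst z"] ker[OF that(2), of "snd z"] r e by (auto simp: c_def d_def)
  have int\<alpha>: "integrable M \<alpha>" and int\<beta>: "integrable M \<beta>"
    using zb e unfolding \<alpha>_def \<beta>_def power2_eq_square
    by (intro integrable_bounded_on_torus(1)[where B="1 * (D * D) * D"] integrable_bounded_on_torus(1)[where B="1 * D * (D * D)"];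
        auto simp: norm_mult intro!: mult_mono)+
  have intcd: "integrable M (\<lambda>\<zeta>. c y \<zeta> * d y \<zeta>)" if "dist y z < e" for y
  proof (rule integrable_bounded_on_torus[where B="D * D"])
    fix \<zeta> :: "complex \<times> complex" assume \<zeta>: "norm (fst \<zeta>) = 1" "norm (snd \<zeta>) = 1"
    have "norm (fst y) \<le> r + e" "norm (snd y) \<le> r + e"
      using norm_triangle_ineq[of "fst z" "fst y - fst z"] norm_triangle_ineq[of "snd z" "snd y - snd z"] r that
        dist_fst_le[of y z] dist_snd_le[of y z] by (auto simp: dist_norm)
    then show "norm (c y \<zeta> * d y \<zeta>) \<le> D * D"
      using ker[OF \<zeta>(1)] ker[OF \<zeta>(2)] e unfolding norm_mult c_def d_def by (intro mult_mono) auto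
  qed simp
  have remainder: "norm (c y \<zeta> * d y \<zeta> - c z \<zeta> * d z \<zeta> - (fst (y - z) * \<alpha> \<zeta> + snd (y - z) * \<beta> \<zeta>))
      \<le> 3 * D ^ 4 * (norm (y - z))\<^sup>2"
    if y: "dist y z < e" and \<zeta>: "norm (fst \<zeta>) = 1" "norm (snd \<zeta>) = 1" for y \<zeta>
  proof -
    define h where "h = y - z"
    define c0 d0 c1 d1 where defs: "c0 = c z \<zeta>" "d0 = d z \<zeta>" "c1 = c y \<zeta>" "d1 = d y \<zeta>"
    define a b where ab: "a = fst h * cnj (fst \<zeta>)" "b = snd h * cnj (snd \<zeta>)"
    have h: "norm a \<le> norm h" "norm b \<le> norm h" "norm h < e"
      using \<zeta> y norm_fst_le[of "fst h" "snd h"] norm_snd_le[of "snd h" "fst h"]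
      by (auto simp: ab norm_mult dist_norm simp flip: h_def)
    have y_eq: "fst y = fst z + fst h" "snd y = snd z + snd h" by (auto simp: h_def)
    have ny: "norm (fst y) \<le> r + e" "norm (snd y) \<le> r + e"
      using norm_triangle_ineq[of "fst z" "fst h"] norm_triangle_ineq[of "snd z" "snd h"] r h \<zeta>
      by (auto simp: y_eq ab norm_mult)
    have bounds: "norm c0 \<le> D" "norm d0 \<le> D" "norm c1 \<le> D" "norm d1 \<le> D"
      using zb[OF \<zeta>] ker(1)[OF \<zeta>(1) ny(1)] ker(1)[OF \<zeta>(2) ny(2)] by (auto simp: defs c_def d_def)
    have "c1 - c0 = a * c0 * c1" "d1 - d0 = b * d0 * d1"
      unfolding defs c_def d_def ab y_eq
      using ker(2)[OF \<zeta>(1)] ker(2)[OF \<zeta>(2)] ny r e y_eq by (intro cauchy_kernel_diff; simp)+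
    then have "c1 = c0 + a * c0 * c1" "d1 = d0 + b * d0 * d1" by (auto simp: algebra_simps)
    \<comment> \<open>Applying the resolvent identities twice leaves three terms, each with two
      factors from \<open>a\<close>, \<open>b\<close> and four kernel factors. This is the source of
      the constant \<open>3 * D ^ 4\<close>.\<close>
    then have "c1 * d1 - c0 * d0 - (a * c0\<^sup>2 * d0 + b * c0 * d0\<^sup>2)
        = a * a * c0 * c0 * c1 * d1 + a * c0 * c0 * (b * d0 * d1) + c0 * (b * b * d0 * d0 * d1)"
      by algebra
    also have "norm \<dots> \<le> norm (a * a * c0 * c0 * c1 * d1) + norm (a * c0 * c0 * (b * d0 * d1))
        + norm (c0 * (b * b * d0 * d0 * d1))"
      by (intro order_trans[OF norm_triangle_ineq] add_right_mono norm_triangle_ineq)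
    also have "\<dots> \<le> norm h * norm h * D * D * D * D + norm h * D * D * (norm h * D * D)
        + D * (norm h * norm h * D * D * D)"
      unfolding norm_mult using h bounds e by (intro add_mono mult_mono) auto
    also have "\<dots> = 3 * D ^ 4 * (norm h)\<^sup>2" by (simp add: power2_eq_square power4_eq_xxxx)
    finally show ?thesis by (simp add: defs ab h_def \<alpha>_def \<beta>_def mult_ac)
  qed
  let ?F = "\<lambda>y. \<integral>\<zeta>. c y \<zeta> * d y \<zeta> \<partial>M"
  have "(?F has_derivative (\<lambda>h. (\<integral>\<zeta>. \<alpha> \<zeta> \<partial>M) * fst h + (\<integral>\<zeta>. \<beta> \<zeta> \<partial>M) * snd h)) (at z)"
  proof (rule has_derivativeI_sandwich[OF e(1)])
    show "bounded_linear (\<lambda>h. (\<integral>\<zeta>. \<alpha> \<zeta> \<partial>M) * fst h + (\<integral>\<zeta>. \<beta> \<zeta> \<partial>M) * snd h)"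
      by (intro bounded_linear_add bounded_linear_const_mult bounded_linear_fst bounded_linear_snd)
    have "((\<lambda>y. 3 * D ^ 4 * norm (y - z)) \<longlongrightarrow> 3 * D ^ 4 * norm (z - z)) (at z)"
      by (intro tendsto_intros)
    then show "((\<lambda>y. 3 * D ^ 4 * norm (y - z)) \<longlongrightarrow> 0) (at z)" by simp
    fix y assume "y \<noteq> z" and y: "dist y z < e"
    have "?F y - ?F z - ((\<integral>\<zeta>. \<alpha> \<zeta> \<partial>M) * fst (y - z) + (\<integral>\<zeta>. \<beta> \<zeta> \<partial>M) * snd (y - z))
        = (\<integral>\<zeta>. c y \<zeta> * d y \<zeta> - c z \<zeta> * d z \<zeta> - (fst (y - z) * \<alpha> \<zeta> + snd (y - z) * \<beta> \<zeta>) \<partial>M)"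
      using intcd[OF y] intcd[of z] e int\<alpha> int\<beta> by (simp add: mult.commute)
    also have "norm \<dots> \<le> 3 * D ^ 4 * (norm (y - z))\<^sup>2"
      by (rule integrable_bounded_on_torus(2)) (use remainder[OF y] in auto)
    finally show "norm (?F y - ?F z - ((\<integral>\<zeta>. \<alpha> \<zeta> \<partial>M) * fst (y - z) + (\<integral>\<zeta>. \<beta> \<zeta> \<partial>M) * snd (y - z)))
        / norm (y - z) \<le> 3 * D ^ 4 * norm (y - z)"
      using \<open>y \<noteq> z\<close> by (simp add: divide_le_eq power2_eq_square mult_ac)
  qed
  then show "\<exists>a b. ((\<lambda>z. \<integral>\<zeta>. cauchy_kernel (fst z) (fst \<zeta>) * cauchy_kernel (snd z) (snd \<zeta>) \<partial>M)
      has_derivative (\<lambda>h. a * fst h + b * snd h)) (at z)"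
    unfolding c_def d_def by blast
qed

text \<open>Both factors are geometric series without constant term, so products of their partial
  sums are finite combinations of conjugates of the vanishing moments. Dominated convergence passes
  to the limit.\<close>

lemma mixed_cauchy_integral_eq_0:
  assumes moments: "\<And>m n. (\<integral>\<zeta>. fst \<zeta> ^ Suc m * cnj (snd \<zeta>) ^ Suc n \<partial>M) = 0"
    and x: "norm x < 1" and y: "norm y < 1"
  shows "(\<integral>\<zeta>. (cauchy_kernel x (fst \<zeta>) - 1) * cnj (cauchy_kernel y (snd \<zeta>) - 1) \<partial>M) = 0"
proof -
  \<comment> \<open>The exponents start at 1, which matches the subtraction of 1 from the Cauchy
    kernel.\<close>
  define S where "S w N = (\<Sum>m<N. w ^ Suc m)" for w :: complex and N
  have S_bound: "norm (S w N) \<le> 1 / (1 - norm w)" if "norm w < 1" for w N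
  proof -
    have "norm (S w N) \<le> (\<Sum>m<N. norm w ^ m)"
      unfolding S_def using that
      by (intro order_trans[OF norm_sum] sum_mono) (simp add: norm_mult norm_power mult_left_le_one_le)
    also have "\<dots> \<le> (\<Sum>m. norm w ^ m)"
      using that by (intro sum_le_suminf summable_geometric) auto
    finally show ?thesis using that by (simp add: suminf_geometric)
  qed
  have S_lim: "S (u * cnj \<zeta>) \<longlonglongrightarrow> cauchy_kernel u \<zeta> - 1" if "norm u < 1" "norm \<zeta> = 1" for u \<zeta>
  proof -
    define w where "w = u * cnj \<zeta>"
    have "norm w < 1" using that by (simp add: w_def norm_mult)
    then have "(\<lambda>m. w * w ^ m) sums (w * (1 / (1 - w)))" by (intro sums_mult geometric_sums)
    moreover have "w * (1 / (1 - w)) = cauchy_kernel u \<zeta> - 1"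
    proof -
      have "1 - w \<noteq> 0" using \<open>norm w < 1\<close> by auto
      then have "w * (1 / (1 - w)) = 1 / (1 - w) - 1" by (simp add: field_simps)
      then show ?thesis by (simp add: cauchy_kernel_def w_def)
    qed
    ultimately show ?thesis by (simp add: sums_def S_def[abs_def] w_def)
  qed
  have [measurable]: "cnj \<in> borel_measurable borel"
    by (intro borel_measurable_continuous_onI continuous_intros)
  define s where "s N \<zeta> = S (x * cnj (fst \<zeta>)) N * cnj (S (y * cnj (snd \<zeta>)) N)" for N \<zeta>
  have [measurable]: "s N \<in> borel_measurable M" for N unfolding s_def S_def by measurable
  have "(\<lambda>N. \<integral>\<zeta>. s N \<zeta> \<partial>M) \<longlonglongrightarrow>
      (\<integral>\<zeta>. (cauchy_kernel x (fst \<zeta>) - 1) * cnj (cauchy_kernel y (snd \<zeta>) - 1) \<partial>M)"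
  proof (rule integral_dominated_convergence[where w="\<lambda>_. 1 / (1 - norm x) * (1 / (1 - norm y))"])
    show "AE \<zeta> in M. (\<lambda>N. s N \<zeta>) \<longlonglongrightarrow>
        (cauchy_kernel x (fst \<zeta>) - 1) * cnj (cauchy_kernel y (snd \<zeta>) - 1)"
      using AE_torus
    proof eventually_elim
      case (elim \<zeta>)
      then show ?case unfolding s_def using x y by (intro tendsto_mult tendsto_cnj S_lim) auto
    qed
    show "AE \<zeta> in M. norm (s N \<zeta>) \<le> 1 / (1 - norm x) * (1 / (1 - norm y))" for N
      using AE_torus
    proof eventually_elim
      case (elim \<zeta>)
      then show ?case
        using S_bound[of "x * cnj (fst \<zeta>)" N] S_bound[of "y * cnj (snd \<zeta>)" N] x y
        unfolding s_def norm_mult complex_mod_cnj by (intro mult_mono) auto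
    qed
  qed measurable
  moreover have "(\<integral>\<zeta>. s N \<zeta> \<partial>M) = 0" for N
  proof -
    define q where "q m n \<zeta> = cnj (fst \<zeta> ^ Suc m * cnj (snd \<zeta>) ^ Suc n)" for m n and \<zeta> :: "complex \<times> complex"
    have "s N \<zeta> = (\<Sum>m<N. \<Sum>n<N. x ^ Suc m * cnj y ^ Suc n * q m n \<zeta>)" for \<zeta>
      unfolding s_def S_def q_def cnj_sum sum_product
      by (intro sum.cong refl) (simp add: power_mult_distrib mult_ac)
    moreover have "integrable M (q m n)" for m n
      unfolding q_def by (rule integrable_bounded_on_torus[where B=1]) (auto simp: norm_mult norm_power)
    moreover have "(\<integral>\<zeta>. q m n \<zeta> \<partial>M) = 0" for m n
    proof -
      have "(\<integral>\<zeta>. q m n \<zeta> \<partial>M) = cnj (\<integral>\<zeta>. fst \<zeta> ^ Suc m * cnj (snd \<zeta>) ^ Suc n \<partial>M)"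
        unfolding q_def by (rule Bochner_Integration.integral_cnj)
      then show ?thesis by (simp only: moments complex_cnj_zero)
    qed
    ultimately show ?thesis by (simp del: power_Suc)
  qed
  ultimately show ?thesis by (simp add: LIMSEQ_const_iff)
qed

text \<open>The holomorphic function is \<open>2 * H - 1\<close> with \<open>H\<close> the double
  Cauchy integral. In the product of two Poisson kernels only the terms mixing
  \<open>z\<^sub>1\<close> with the conjugate of \<open>z\<^sub>2\<close> stand in the way, and the
  moment condition kills their integral.\<close>

lemma positive_RP_measureI:
  assumes moments: "\<And>m n. (\<integral>\<zeta>. fst \<zeta> ^ Suc m * cnj (snd \<zeta>) ^ Suc n \<partial>M) = 0"
  shows "positive_RP_measure M"
proof -
  define H where "H z = (\<integral>\<zeta>. cauchy_kernel (fst z) (fst \<zeta>) * cauchy_kernel (snd z) (snd \<zeta>) \<partial>M)" for z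
  have "holomorphic2_on (\<lambda>z. 2 * H z - 1) bidisc"
    unfolding holomorphic2_on_def
  proof
    fix z :: "complex \<times> complex" assume "z \<in> bidisc"
    then obtain a b where "(H has_derivative (\<lambda>h. a * fst h + b * snd h)) (at z)"
      using holomorphic2_cauchy_integral unfolding H_def holomorphic2_on_def by blast
    then have "((\<lambda>z. 2 * H z - 1) has_derivative (\<lambda>h. (2 * a) * fst h + (2 * b) * snd h)) (at z)"
      by (auto intro!: derivative_eq_intros simp: algebra_simps)
    then show "\<exists>a b. ((\<lambda>z. 2 * H z - 1) has_derivative (\<lambda>h. a * fst h + b * snd h)) (at z)" by blast
  qed
  moreover have "poisson2 M z = Re (2 * H z - 1)" if "z \<in> bidisc" for z
  proof -
    have z: "norm (fst z) < 1" "norm (snd z) < 1" using that by (auto simp: bidisc_def)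
    define c where "c \<zeta> = cauchy_kernel (fst z) (fst \<zeta>)" for \<zeta> :: "complex \<times> complex"
    define d where "d \<zeta> = cauchy_kernel (snd z) (snd \<zeta>)" for \<zeta> :: "complex \<times> complex"
    have [measurable]: "c \<in> borel_measurable M" "d \<in> borel_measurable M"
      unfolding c_def d_def by measurable
    have [measurable]: "cnj \<in> borel_measurable borel"
      by (intro borel_measurable_continuous_onI continuous_intros)
    define C D where CD: "C = 1 / (1 - norm (fst z))" "D = 1 / (1 - norm (snd z))"
    have CD0: "C \<ge> 0" "D \<ge> 0" using z by (auto simp: CD)
    have b: "norm (c \<zeta>) \<le> C" "norm (d \<zeta>) \<le> D" if "norm (fst \<zeta>) = 1" "norm (snd \<zeta>) = 1" for \<zeta>
      using cauchy_kernel_bound(2)[OF that(1) order_refl z(1)] cauchy_kernel_bound(2)[OF that(2) order_refl z(2)]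
      by (auto simp: c_def d_def CD)
    have int1: "integrable M (\<lambda>\<zeta>. c \<zeta> * d \<zeta>)"
      by (rule integrable_bounded_on_torus[where B="C * D"]) (auto simp: norm_mult b CD0 intro!: mult_mono)
    have int2: "integrable M (\<lambda>\<zeta>. (c \<zeta> - 1) * cnj (d \<zeta> - 1))"
    proof (rule integrable_bounded_on_torus[where B="(C + 1) * (D + 1)"])
      fix \<zeta> :: "complex \<times> complex" assume \<zeta>: "norm (fst \<zeta>) = 1" "norm (snd \<zeta>) = 1"
      have "norm (c \<zeta> - 1) \<le> C + 1" "norm (d \<zeta> - 1) \<le> D + 1"
        using norm_triangle_ineq4[of "c \<zeta>" 1] norm_triangle_ineq4[of "d \<zeta>" 1] b[OF \<zeta>] by auto
      then show "norm ((c \<zeta> - 1) * cnj (d \<zeta> - 1)) \<le> (C + 1) * (D + 1)"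
        unfolding norm_mult complex_mod_cnj using CD0 by (intro mult_mono) auto
    qed measurable
    \<comment> \<open>Put \<open>c = 1 + G\<close>, \<open>d = 1 + H\<close>: the product of the Poisson kernels \<open>1 + 2 Re G\<close> and \<open>1 + 2 Re H\<close>
      is the real part of \<open>1 + 2 G + 2 H + 2 G H + 2 G cnj H\<close>, and the last term integrates to \<open>0\<close>.\<close>
    have "poisson2 M z = (\<integral>\<zeta>. Re (2 * (c \<zeta> * d \<zeta>) - 1 + 2 * ((c \<zeta> - 1) * cnj (d \<zeta> - 1))) \<partial>M)"
      unfolding poisson2_def
    proof (rule integral_cong_AE)
      show "AE \<zeta> in M. (1 - (norm (fst z))\<^sup>2) / (norm (fst \<zeta> - fst z))\<^sup>2 *
          ((1 - (norm (snd z))\<^sup>2) / (norm (snd \<zeta> - snd z))\<^sup>2)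
          = Re (2 * (c \<zeta> * d \<zeta>) - 1 + 2 * ((c \<zeta> - 1) * cnj (d \<zeta> - 1)))"
        using AE_torus
      proof eventually_elim
        case (elim \<zeta>)
        have eqs: "(1 - (norm (fst z))\<^sup>2) / (norm (fst \<zeta> - fst z))\<^sup>2 = 2 * Re (c \<zeta>) - 1"
          "(1 - (norm (snd z))\<^sup>2) / (norm (snd \<zeta> - snd z))\<^sup>2 = 2 * Re (d \<zeta>) - 1"
          using poisson_kernel_conv_cauchy_kernel[of "fst \<zeta>" "fst z", THEN arg_cong[where f=Re]]
            poisson_kernel_conv_cauchy_kernel[of "snd \<zeta>" "snd z", THEN arg_cong[where f=Re]] elim z
          by (simp_all only: Re_complex_of_real) (simp_all add: c_def d_def)
        show ?case unfolding eqs by (simp add: algebra_simps)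
      qed
    qed measurable
    also have "\<dots> = Re (\<integral>\<zeta>. 2 * (c \<zeta> * d \<zeta>) - 1 + 2 * ((c \<zeta> - 1) * cnj (d \<zeta> - 1)) \<partial>M)"
      using int1 int2 by (intro integral_Re) auto
    also have "(\<integral>\<zeta>. 2 * (c \<zeta> * d \<zeta>) - 1 + 2 * ((c \<zeta> - 1) * cnj (d \<zeta> - 1)) \<partial>M)
        = 2 * (\<integral>\<zeta>. c \<zeta> * d \<zeta> \<partial>M) - 1 + 2 * (\<integral>\<zeta>. (c \<zeta> - 1) * cnj (d \<zeta> - 1) \<partial>M)"
      using int1 int2 by (simp add: prob_space del: complex_cnj_diff)
    also have "(\<integral>\<zeta>. (c \<zeta> - 1) * cnj (d \<zeta> - 1) \<partial>M) = 0"
      unfolding c_def d_def by (rule mixed_cauchy_integral_eq_0[OF moments z])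
    finally show ?thesis by (simp add: H_def c_def d_def)
  qed
  ultimately show ?thesis
    unfolding positive_RP_measure_def using sets_M null_M finite_measure_axioms by blast
qed

end

section \<open>Uniform closure of the ideal\<close>

lemma torus2_subset_closed_bidisc: "torus2 \<subseteq> closed_bidisc"
  by (auto simp: torus2_def closed_bidisc_def)

lemma bidisc_algebra_const: "(\<lambda>z. c) \<in> bidisc_algebra"
  by (auto simp: bidisc_algebra_def holomorphic2_on_def intro!: exI[of _ 0])

lemma bidisc_algebra_fst: "fst \<in> bidisc_algebra"
proof -
  have "(fst has_derivative (\<lambda>h. 1 * fst h + 0 * snd h)) (at z)" for z :: "complex \<times> complex"
    using has_derivative_fst[OF has_derivative_ident] by simp
  then show ?thesis
    unfolding bidisc_algebra_def holomorphic2_on_def mem_Collect_eq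
    by (blast intro: continuous_on_fst[OF continuous_on_id])
qed

lemma bidisc_algebra_snd: "snd \<in> bidisc_algebra"
proof -
  have "(snd has_derivative (\<lambda>h. 0 * fst h + 1 * snd h)) (at z)" for z :: "complex \<times> complex"
    using has_derivative_snd[OF has_derivative_ident] by simp
  then show ?thesis
    unfolding bidisc_algebra_def holomorphic2_on_def mem_Collect_eq
    by (blast intro: continuous_on_snd[OF continuous_on_id])
qed

lemma bidisc_algebra_add:
  assumes "f \<in> bidisc_algebra" "g \<in> bidisc_algebra"
  shows "(\<lambda>z. f z + g z) \<in> bidisc_algebra"
proof -
  have "\<exists>a b. ((\<lambda>z. f z + g z) has_derivative (\<lambda>h. a * fst h + b * snd h)) (at z)" if z: "z \<in> bidisc" for z
  proof -
    obtain a b a' b' where "(f has_derivative (\<lambda>h. a * fst h + b * snd h)) (at z)"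
      "(g has_derivative (\<lambda>h. a' * fst h + b' * snd h)) (at z)"
      using assms z unfolding bidisc_algebra_def holomorphic2_on_def by blast
    then have "((\<lambda>z. f z + g z) has_derivative (\<lambda>h. (a + a') * fst h + (b + b') * snd h)) (at z)"
      by (auto intro!: derivative_eq_intros simp: algebra_simps)
    then show ?thesis by blast
  qed
  with assms show ?thesis
    by (auto simp: bidisc_algebra_def holomorphic2_on_def intro!: continuous_intros)
qed

lemma bidisc_algebra_mult:
  assumes "f \<in> bidisc_algebra" "g \<in> bidisc_algebra"
  shows "(\<lambda>z. f z * g z) \<in> bidisc_algebra"
proof -
  have "\<exists>a b. ((\<lambda>z. f z * g z) has_derivative (\<lambda>h. a * fst h + b * snd h)) (at z)" if z: "z \<in> bidisc" for z
  proof -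
    obtain a b a' b' where "(f has_derivative (\<lambda>h. a * fst h + b * snd h)) (at z)"
      "(g has_derivative (\<lambda>h. a' * fst h + b' * snd h)) (at z)"
      using assms z unfolding bidisc_algebra_def holomorphic2_on_def by blast
    then have "((\<lambda>z. f z * g z) has_derivative
        (\<lambda>h. (f z * a' + a * g z) * fst h + (f z * b' + b * g z) * snd h)) (at z)"
      by (auto intro!: derivative_eq_intros simp: algebra_simps)
    then show ?thesis by blast
  qed
  with assms show ?thesis
    by (auto simp: bidisc_algebra_def holomorphic2_on_def intro!: continuous_intros)
qed

lemma bidisc_algebra_power: "f \<in> bidisc_algebra \<Longrightarrow> (\<lambda>z. f z ^ n) \<in> bidisc_algebra"
  by (induction n) (auto intro: bidisc_algebra_const bidisc_algebra_mult)

lemma bidisc_algebra_sum: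
  "finite I \<Longrightarrow> (\<And>i. i \<in> I \<Longrightarrow> f i \<in> bidisc_algebra) \<Longrightarrow> (\<lambda>z. \<Sum>i\<in>I. f i z) \<in> bidisc_algebra"
  by (induction I rule: finite_induct) (auto intro: bidisc_algebra_const bidisc_algebra_add)

lemma bidisc_algebra_uminus:
  assumes "f \<in> bidisc_algebra"
  shows "(\<lambda>z. - f z) \<in> bidisc_algebra"
  using bidisc_algebra_mult[OF bidisc_algebra_const[of "-1"] assms] by simp

lemma bidisc_algebra0_subset: "f \<in> bidisc_algebra0 \<Longrightarrow> f \<in> bidisc_algebra"
  by (auto simp: bidisc_algebra0_def intro!: bidisc_algebra_mult bidisc_algebra_fst bidisc_algebra_snd)

lemma bidisc_algebra0_ideal:
  assumes "h \<in> bidisc_algebra" "f \<in> bidisc_algebra0"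
  shows "(\<lambda>z. h z * f z) \<in> bidisc_algebra0"
proof -
  obtain g where g: "f = (\<lambda>z. fst z * snd z * g z)" "g \<in> bidisc_algebra"
    using assms(2) by (auto simp: bidisc_algebra0_def)
  have "(\<lambda>z. h z * f z) = (\<lambda>z. fst z * snd z * (h z * g z))" by (simp add: g(1) mult_ac)
  with bidisc_algebra_mult[OF assms(1) g(2)] show ?thesis
    unfolding bidisc_algebra0_def mem_Collect_eq by (intro exI conjI)
qed

lemma bidisc_algebra0_add:
  assumes "f \<in> bidisc_algebra0" "g \<in> bidisc_algebra0"
  shows "(\<lambda>z. f z + g z) \<in> bidisc_algebra0"
proof -
  obtain f' g' where "f = (\<lambda>z. fst z * snd z * f' z)" "f' \<in> bidisc_algebra"
    "g = (\<lambda>z. fst z * snd z * g' z)" "g' \<in> bidisc_algebra"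
    using assms by (auto simp: bidisc_algebra0_def)
  then show ?thesis
    unfolding bidisc_algebra0_def
    by (auto intro!: exI[of _ "\<lambda>z. f' z + g' z"] bidisc_algebra_add simp: algebra_simps)
qed

section \<open>Uniform approximation on \<open>K\<close> by elements of the ideal\<close>

definition approximable :: "(complex \<times> complex) set \<Rightarrow> (complex \<times> complex \<Rightarrow> complex) \<Rightarrow> bool" where
  "approximable K g \<longleftrightarrow> (\<forall>\<epsilon>>0. \<exists>f\<in>bidisc_algebra0. \<forall>x\<in>K. norm (f x - g x) < \<epsilon>)"

lemma approximable_bidisc_algebra0: "f \<in> bidisc_algebra0 \<Longrightarrow> approximable K f"
  unfolding approximable_def by force

lemma approximable_closed:
  assumes "\<And>\<epsilon>. \<epsilon> > 0 \<Longrightarrow> \<exists>h. approximable K h \<and> (\<forall>x\<in>K. norm (h x - g x) < \<epsilon>)"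
  shows "approximable K g"
  unfolding approximable_def
proof (intro allI impI)
  fix \<epsilon> :: real assume "\<epsilon> > 0"
  then obtain h where h: "approximable K h" "\<And>x. x \<in> K \<Longrightarrow> norm (h x - g x) < \<epsilon> / 2"
    using assms[of "\<epsilon> / 2"] by auto
  with \<open>\<epsilon> > 0\<close> obtain f where f: "f \<in> bidisc_algebra0" "\<And>x. x \<in> K \<Longrightarrow> norm (f x - h x) < \<epsilon> / 2"
    unfolding approximable_def by (meson half_gt_zero)
  have "norm (f x - g x) < \<epsilon>" if "x \<in> K" for x
    using norm_triangle_ineq[of "f x - h x" "h x - g x"] f(2)[OF that] h(2)[OF that] by simp
  with f(1) show "\<exists>f\<in>bidisc_algebra0. \<forall>x\<in>K. norm (f x - g x) < \<epsilon>" by blast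
qed

lemma approximable_add:
  assumes "approximable K f" "approximable K g"
  shows "approximable K (\<lambda>x. f x + g x)"
  unfolding approximable_def
proof (intro allI impI)
  fix \<epsilon> :: real assume "\<epsilon> > 0"
  then obtain f' g' where *: "f' \<in> bidisc_algebra0" "\<And>x. x \<in> K \<Longrightarrow> norm (f' x - f x) < \<epsilon> / 2"
    "g' \<in> bidisc_algebra0" "\<And>x. x \<in> K \<Longrightarrow> norm (g' x - g x) < \<epsilon> / 2"
    using assms unfolding approximable_def by (meson half_gt_zero)
  have "norm (f' x + g' x - (f x + g x)) < \<epsilon>" if "x \<in> K" for x
    using norm_diff_triangle_ineq[of "f' x" "g' x" "f x" "g x"] *(2)[OF that] *(4)[OF that] by simp
  with * show "\<exists>h\<in>bidisc_algebra0. \<forall>x\<in>K. norm (h x - (f x + g x)) < \<epsilon>"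
    by (intro bexI[of _ "\<lambda>x. f' x + g' x"] bidisc_algebra0_add) auto
qed

text \<open>Replacing \<open>f\<close> by a nearby element of the ideal changes the product by
  little because \<open>g\<close> is bounded. Products with ideal elements are thus the only case to
  check.\<close>

lemma approximable_mult_bounded:
  assumes f: "approximable K f" and g: "\<And>x. x \<in> K \<Longrightarrow> norm (g x) \<le> B"
    and ideal: "\<And>h. h \<in> bidisc_algebra0 \<Longrightarrow> approximable K (\<lambda>x. h x * g x)"
  shows "approximable K (\<lambda>x. f x * g x)"
proof (rule approximable_closed)
  fix \<epsilon> :: real assume "\<epsilon> > 0"
  \<comment> \<open>The maximum with 1 keeps the divisor positive while remaining a bound for
    \<open>g\<close>.\<close>
  define B' where "B' = max B 1"
  have "\<epsilon> / B' > 0" using \<open>\<epsilon> > 0\<close> by (simp add: B'_def)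
  then obtain h where h: "h \<in> bidisc_algebra0" "\<And>x. x \<in> K \<Longrightarrow> norm (h x - f x) < \<epsilon> / B'"
    using f unfolding approximable_def by blast
  have "norm (h x * g x - f x * g x) < \<epsilon>" if "x \<in> K" for x
  proof -
    have "norm (h x * g x - f x * g x) = norm (h x - f x) * norm (g x)"
      by (simp add: norm_mult left_diff_distrib[symmetric])
    also have "\<dots> \<le> norm (h x - f x) * B'"
      using g[OF that] by (intro mult_left_mono) (auto simp: B'_def)
    also have "\<dots> < \<epsilon> / B' * B'"
      using h(2)[OF that] by (intro mult_strict_right_mono) (auto simp: B'_def)
    finally show ?thesis by (simp add: B'_def)
  qed
  with ideal[OF h(1)] show "\<exists>h. approximable K h \<and> (\<forall>x\<in>K. norm (h x - f x * g x) < \<epsilon>)" by blast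
qed

section \<open>Density once some \<open>f\<close> in the ideal has positive real part on
  \<open>K\<close>\<close>

context
  fixes K :: "(complex \<times> complex) set" and f :: "complex \<times> complex \<Rightarrow> complex"
  assumes K: "K \<subseteq> torus2" "compact K"
    and f: "f \<in> bidisc_algebra0" and pos: "\<And>x. x \<in> K \<Longrightarrow> 0 < Re (f x)"
begin

lemma bidisc_algebra_continuous_on: "h \<in> bidisc_algebra \<Longrightarrow> continuous_on K h"
  using K torus2_subset_closed_bidisc by (auto simp: bidisc_algebra_def intro: continuous_on_subset)

lemma bidisc_algebra_bounded:
  assumes "h \<in> bidisc_algebra"
  obtains B where "\<And>x. x \<in> K \<Longrightarrow> norm (h x) \<le> B"
proof -
  have "bounded (h ` K)"
    using K bidisc_algebra_continuous_on[OF assms] by (intro compact_imp_bounded compact_continuous_image)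
  then show ?thesis using that by (auto simp: bounded_iff)
qed

text \<open>For small \<open>c > 0\<close> the function \<open>1 - c f\<close> has modulus less than \<open>1\<close> on \<open>K\<close>, so
  \<open>1 - (1 - c f)\<^sup>n\<close>, a multiple of \<open>f\<close>, tends to \<open>1\<close>.\<close>

lemma approximable_1: "approximable K (\<lambda>x. 1)"
proof (cases "K = {}")
  case True
  then show ?thesis using f by (auto simp: approximable_def)
next
  case False
  have cont: "continuous_on K f" by (intro bidisc_algebra_continuous_on bidisc_algebra0_subset f)
  then have "continuous_on K (\<lambda>x. Re (f x))" by (intro continuous_intros)
  then obtain x0 where x0: "x0 \<in> K" "\<And>x. x \<in> K \<Longrightarrow> Re (f x0) \<le> Re (f x)"
    using continuous_attains_inf[OF K(2) False] by blast
  define \<delta> where "\<delta> = Re (f x0)"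
  have "\<delta> > 0" using pos x0 by (simp add: \<delta>_def)
  obtain B where B: "\<And>x. x \<in> K \<Longrightarrow> norm (f x) \<le> B"
    using bidisc_algebra_bounded[OF bidisc_algebra0_subset[OF f]] by blast
  have "\<delta> \<le> B" using B[OF x0(1)] complex_Re_le_cmod[of "f x0"] by (simp add: \<delta>_def)
  \<comment> \<open>This value minimises
    \<open>1 - 2 * c * \<delta> + c\<^sup>2 * B\<^sup>2\<close>, the upper bound for the squared
    modulus of \<open>1 - c * f x\<close>; the minimum is \<open>q\<^sup>2\<close>.\<close>
  define c where "c = \<delta> / B\<^sup>2"
  define q where "q = sqrt (1 - (\<delta> / B)\<^sup>2)"
  have "B > 0" "c > 0" using \<open>\<delta> > 0\<close> \<open>\<delta> \<le> B\<close> by (auto simp: c_def)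
  have "(\<delta> / B)\<^sup>2 \<le> 1" using \<open>\<delta> > 0\<close> \<open>\<delta> \<le> B\<close> by (intro power_le_one) auto
  then have q: "0 \<le> q" "q < 1" using \<open>\<delta> > 0\<close> \<open>B > 0\<close> by (auto simp: q_def)
  have small: "norm (1 - c * f x) \<le> q" if "x \<in> K" for x
  proof -
    have "(norm (1 - c * f x))\<^sup>2 = 1 - 2 * c * Re (f x) + c\<^sup>2 * (norm (f x))\<^sup>2"
      unfolding cmod_power2 by (simp add: power2_eq_square algebra_simps)
    also have "\<dots> \<le> 1 - 2 * c * \<delta> + c\<^sup>2 * B\<^sup>2"
      using x0(2)[OF that] B[OF that] \<open>c > 0\<close>
      by (intro add_mono diff_mono mult_left_mono power_mono) (auto simp: \<delta>_def)
    also have "\<dots> = 1 - (\<delta> / B)\<^sup>2"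
      using \<open>B > 0\<close> by (simp add: c_def power2_eq_square field_simps)
    finally show ?thesis unfolding q_def by (rule real_le_rsqrt)
  qed
  show ?thesis
    unfolding approximable_def
  proof (intro allI impI)
    fix \<epsilon> :: real assume "\<epsilon> > 0"
    then obtain n where n: "q ^ n < \<epsilon>" using real_arch_pow_inv[OF _ q(2)] by blast
    define h where "h z = (c * (\<Sum>k<n. (1 - c * f z) ^ k)) * f z" for z
    have "(\<lambda>z. 1 + - (complex_of_real c * f z)) \<in> bidisc_algebra"
      using f by (intro bidisc_algebra_add bidisc_algebra_uminus bidisc_algebra_mult
          bidisc_algebra_const bidisc_algebra0_subset)
    then have "h \<in> bidisc_algebra0"
      unfolding h_def using f
      by (intro bidisc_algebra0_ideal bidisc_algebra_mult bidisc_algebra_const bidisc_algebra_sum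
          bidisc_algebra_power) auto
    moreover have "norm (h x - 1) < \<epsilon>" if "x \<in> K" for x
    proof -
      have "1 - (1 - c * f x) ^ n = h x"
        by (simp add: one_diff_power_eq h_def mult_ac)
      then have "h x - 1 = - ((1 - c * f x) ^ n)" by (simp flip: \<open>_ = h x\<close>)
      then have "norm (h x - 1) = norm (1 - c * f x) ^ n" by (simp add: norm_power)
      also have "\<dots> \<le> q ^ n" using small[OF that] by (intro power_mono) auto
      finally show ?thesis using n by simp
    qed
    ultimately show "\<exists>f\<in>bidisc_algebra0. \<forall>x\<in>K. norm (f x - 1) < \<epsilon>" by blast
  qed
qed

text \<open>Write \<open>h = 1 * h\<close>: ideal elements approximating 1, multiplied by the
  bounded function \<open>h\<close>, stay in the ideal.\<close>

lemma approximable_bidisc_algebra: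
  assumes "h \<in> bidisc_algebra"
  shows "approximable K h"
proof -
  obtain B where "\<And>x. x \<in> K \<Longrightarrow> norm (h x) \<le> B" using bidisc_algebra_bounded[OF assms] by blast
  moreover have "approximable K (\<lambda>x. g x * h x)" if "g \<in> bidisc_algebra0" for g
    using approximable_bidisc_algebra0[OF bidisc_algebra0_ideal[OF assms that]] by (simp add: mult.commute)
  ultimately have "approximable K (\<lambda>x. 1 * h x)" using approximable_1 by (rule approximable_mult_bounded[rotated])
  then show ?thesis by simp
qed

text \<open>An approximable \<open>h\<close> is bounded, being within 1 of a bounded ideal element.
  Approximating first \<open>h\<close> and then \<open>g\<close> reduces the product to one of two
  ideal elements.\<close>

lemma approximable_mult:
  assumes g: "approximable K g" and h: "approximable K h"
  shows "approximable K (\<lambda>x. g x * h x)"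
proof -
  obtain h' where h': "h' \<in> bidisc_algebra0" "\<And>x. x \<in> K \<Longrightarrow> norm (h' x - h x) < 1"
    using h unfolding approximable_def by (meson zero_less_one)
  obtain B where B: "\<And>x. x \<in> K \<Longrightarrow> norm (h' x) \<le> B"
    using bidisc_algebra_bounded[OF bidisc_algebra0_subset[OF h'(1)]] by blast
  have "norm (h x) \<le> B + 1" if "x \<in> K" for x
    using norm_triangle_ineq3[of "h x" "h' x"] B[OF that] h'(2)[OF that] by (simp add: norm_minus_commute)
  moreover have "approximable K (\<lambda>x. k x * h x)" if k: "k \<in> bidisc_algebra0" for k
  proof -
    obtain C where C: "\<And>x. x \<in> K \<Longrightarrow> norm (k x) \<le> C"
      using bidisc_algebra_bounded[OF bidisc_algebra0_subset[OF k]] by blast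
    have "approximable K (\<lambda>x. h x * k x)"
    proof (rule approximable_mult_bounded[OF h])
      show "norm (k x) \<le> C" if "x \<in> K" for x using C that .
      show "approximable K (\<lambda>x. g x * k x)" if "g \<in> bidisc_algebra0" for g
        using that k by (intro approximable_bidisc_algebra0 bidisc_algebra0_ideal bidisc_algebra0_subset)
    qed
    then show ?thesis by (simp add: mult.commute)
  qed
  ultimately show ?thesis by (rule approximable_mult_bounded[OF g])
qed

lemma approximable_cnj:
  shows "approximable K (\<lambda>x. cnj (fst x))" "approximable K (\<lambda>x. cnj (snd x))"
proof -
  have near: "\<exists>g h. approximable K g \<and> approximable K h \<and>
      (\<forall>x\<in>K. norm (g x - cnj (fst x)) < \<epsilon> \<and> norm (h x - cnj (snd x)) < \<epsilon>)" if \<epsilon>: "\<epsilon> > 0" for \<epsilon> :: real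
  proof -
    obtain u where u: "u \<in> bidisc_algebra0" "\<And>x. x \<in> K \<Longrightarrow> norm (u x - 1) < \<epsilon>"
      using approximable_1 \<epsilon> unfolding approximable_def by blast
    then obtain h where h: "h \<in> bidisc_algebra" "u = (\<lambda>z. fst z * snd z * h z)"
      by (auto simp: bidisc_algebra0_def)
    have "norm (snd x * h x - cnj (fst x)) < \<epsilon> \<and> norm (fst x * h x - cnj (snd x)) < \<epsilon>" if "x \<in> K" for x
    proof -
      have n: "norm (fst x) = 1" "norm (snd x) = 1" using that K by (auto simp: torus2_def)
      \<comment> \<open>Multiplication by a unimodular coordinate preserves the modulus and turns
        both errors into \<open>u x - 1\<close>.\<close>
      have "norm (snd x * h x - cnj (fst x)) = norm (fst x * (snd x * h x - cnj (fst x)))"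
        "norm (fst x * h x - cnj (snd x)) = norm (snd x * (fst x * h x - cnj (snd x)))"
        using n by (simp_all add: norm_mult)
      moreover have "fst x * cnj (fst x) = 1" "snd x * cnj (snd x) = 1"
        using n by (simp_all add: complex_norm_square[symmetric])
      ultimately show ?thesis using u(2)[OF that] by (simp add: h(2) right_diff_distrib mult_ac)
    qed
    moreover have "approximable K (\<lambda>x. snd x * h x)" "approximable K (\<lambda>x. fst x * h x)"
      using h(1) by (auto intro!: approximable_bidisc_algebra bidisc_algebra_mult bidisc_algebra_fst bidisc_algebra_snd)
    ultimately show ?thesis by blast
  qed
  show "approximable K (\<lambda>x. cnj (fst x))"
    by (rule approximable_closed, drule near, blast)
  show "approximable K (\<lambda>x. cnj (snd x))"
    by (rule approximable_closed, drule near, blast)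
qed

text \<open>A real-linear functional on \<open>\<complex>\<^sup>2\<close> is a real combination of
  the real and imaginary parts of the coordinates, hence a complex combination of the coordinates
  and their conjugates. Sums and products follow from the closure properties.\<close>

lemma approximable_real_polynomial:
  "real_polynomial_function p \<Longrightarrow> approximable K (\<lambda>x. complex_of_real (p x))"
proof (induction rule: real_polynomial_function.induct)
  case (linear p)
  interpret bounded_linear p by fact
  have Re_Im: "complex_of_real (Re w) = 1 / 2 * w + 1 / 2 * cnj w"
    "complex_of_real (Im w) = - \<i> / 2 * w + \<i> / 2 * cnj w" for w
    by (auto simp: complex_eq_iff)
  have "x = Re (fst x) *\<^sub>R (1, 0) + Im (fst x) *\<^sub>R (\<i>, 0) + Re (snd x) *\<^sub>R (0, 1) + Im (snd x) *\<^sub>R (0, \<i>)"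
    for x :: "complex \<times> complex"
    by (auto simp: prod_eq_iff complex_eq_iff)
  then have *: "p x = p (Re (fst x) *\<^sub>R (1, 0) + Im (fst x) *\<^sub>R (\<i>, 0) + Re (snd x) *\<^sub>R (0, 1) + Im (snd x) *\<^sub>R (0, \<i>))"
    for x by (rule arg_cong)
  define A B C D where ABCD: "A = p (1, 0)" "B = p (\<i>, 0)" "C = p (0, 1)" "D = p (0, \<i>)"
  have eq: "p x = A * Re (fst x) + B * Im (fst x) + C * Re (snd x) + D * Im (snd x)" for x
    unfolding ABCD by (rule trans[OF *]) (simp only: add scale real_scaleR_def mult.commute)
  show ?case
    unfolding eq of_real_add of_real_mult Re_Im
    by (intro approximable_add approximable_mult approximable_cnj approximable_bidisc_algebra
        bidisc_algebra_const bidisc_algebra_fst bidisc_algebra_snd)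
next
  case (const c)
  show ?case by (intro approximable_bidisc_algebra bidisc_algebra_const)
next
  case (add p q)
  then show ?case by (simp add: approximable_add)
next
  case (mult p q)
  then show ?case by (simp add: approximable_mult)
qed

lemma approximable_continuous:
  assumes "continuous_on K g"
  shows "approximable K g"
proof (rule approximable_closed)
  fix \<epsilon> :: real assume "\<epsilon> > 0"
  then obtain p where p: "polynomial_function p" "\<And>x. x \<in> K \<Longrightarrow> norm (g x - p x) < \<epsilon>"
    using Stone_Weierstrass_polynomial_function[OF K(2) assms, of \<epsilon>] by auto
  have "real_polynomial_function (\<lambda>x. Re (p x))" "real_polynomial_function (\<lambda>x. Im (p x))"
    using p(1)[unfolded polynomial_function_def, rule_format, OF bounded_linear_Re]
      p(1)[unfolded polynomial_function_def, rule_format, OF bounded_linear_Im] by (simp_all only: o_def)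
  then have "approximable K (\<lambda>x. complex_of_real (Re (p x)) + \<i> * complex_of_real (Im (p x)))"
    by (intro approximable_add approximable_mult approximable_real_polynomial approximable_bidisc_algebra
        bidisc_algebra_const)
  then have "approximable K p" by (simp add: complex_eq[symmetric])
  with p(2) show "\<exists>h. approximable K h \<and> (\<forall>x\<in>K. norm (h x - g x) < \<epsilon>)"
    by (auto simp: norm_minus_commute)
qed

end

section \<open>Density\<close>

lemma Tmap_image_torus2: "S \<subseteq> torus2 \<Longrightarrow> Tmap ` S \<subseteq> torus2"
  by (auto simp: Tmap_def torus2_def)

lemma Tmap_Tmap: "Tmap (Tmap z) = z"
  by (simp add: Tmap_def)

lemma continuous_on_Tmap: "continuous_on A Tmap"
  unfolding Tmap_def by (intro continuous_intros)

text \<open>By contradiction: every finite family of moments can then be made small by a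
  distribution on \<open>K\<close>. A weak limit annihilates all of them, and its image under
  \<open>Tmap\<close> is a positive RP-measure of mass 1 on \<open>S\<close>.\<close>

lemma exists_positive_real_part:
  assumes S: "S \<subseteq> torus2" "compact S" "S \<noteq> {}"
    and no_RP: "\<And>M. positive_RP_measure M \<Longrightarrow> emeasure M (- S) = 0 \<Longrightarrow> emeasure M UNIV = 0"
  shows "\<exists>f\<in>bidisc_algebra0. \<forall>x\<in>Tmap ` S. 0 < Re (f x)"
proof (rule ccontr)
  assume no_f: "\<not> ?thesis"
  define K where "K = Tmap ` S"
  have K: "K \<subseteq> torus2" "compact K" "K \<noteq> {}"
    using S unfolding K_def by (auto intro!: Tmap_image_torus2 compact_continuous_image continuous_on_Tmap)
  \<comment> \<open>The exponents are at least 1, so every combination of these monomials contains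
    the factor \<open>fst z * snd z\<close> and lies in the ideal.\<close>
  define e where "e i z = fst z ^ Suc (fst i) * snd z ^ Suc (snd i)" for i :: "nat \<times> nat" and z :: "complex \<times> complex"
  \<comment> \<open>The grid of exponents grows while the bound shrinks, so each fixed moment tends
    to 0 along the resulting sequence.\<close>
  have "\<exists>p. finite (set_pmf p) \<and> set_pmf p \<subseteq> K \<and>
      (\<Sum>i\<in>{..<N} \<times> {..<N}. (norm (measure_pmf.expectation p (e i)))\<^sup>2) < 1 / Suc N" for N
  proof (rule ccontr)
    assume "\<not> ?thesis"
    then have far: "1 / Suc N \<le> (\<Sum>i\<in>{..<N} \<times> {..<N}. (norm (measure_pmf.expectation p (e i)))\<^sup>2)"
      if "finite (set_pmf p)" "set_pmf p \<subseteq> K" for p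
      using that by (meson not_le)
    have "\<exists>c. \<forall>x\<in>K. 0 < Re (\<Sum>i\<in>{..<N} \<times> {..<N}. c i * e i x)"
    proof (rule finite_moment_alternative[OF _ K(3) _ _ far])
      show "norm (e i x) \<le> 1" if "x \<in> K" for i x
        using that K(1) by (auto simp: e_def torus2_def norm_mult norm_power)
    qed auto
    then obtain c where c: "\<And>x. x \<in> K \<Longrightarrow> 0 < Re (\<Sum>i\<in>{..<N} \<times> {..<N}. c i * e i x)" by blast
    define g where "g z = (\<Sum>i\<in>{..<N} \<times> {..<N}. c i * (fst z ^ fst i * snd z ^ snd i))" for z :: "complex \<times> complex"
    have "g \<in> bidisc_algebra"
      unfolding g_def by (intro bidisc_algebra_sum bidisc_algebra_mult bidisc_algebra_power
          bidisc_algebra_const bidisc_algebra_fst bidisc_algebra_snd) auto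
    then have "(\<lambda>z. fst z * snd z * g z) \<in> bidisc_algebra0" by (auto simp: bidisc_algebra0_def)
    moreover have "fst z * snd z * g z = (\<Sum>i\<in>{..<N} \<times> {..<N}. c i * e i z)" for z
      by (simp add: g_def e_def sum_distrib_left mult_ac)
    then have "\<forall>z\<in>Tmap ` S. 0 < Re (fst z * snd z * g z)" using c unfolding K_def by simp
    ultimately have "\<exists>f\<in>bidisc_algebra0. \<forall>x\<in>Tmap ` S. 0 < Re (f x)"
      by (intro bexI[of _ "\<lambda>z. fst z * snd z * g z"])
    with no_f show False by contradiction
  qed
  then have "\<forall>N. \<exists>p. set_pmf p \<subseteq> K \<and>
      (\<Sum>i\<in>{..<N} \<times> {..<N}. (norm (measure_pmf.expectation p (e i)))\<^sup>2) < 1 / Suc N"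
    by blast
  from choice[OF this] obtain p where p: "\<And>N. set_pmf (p N) \<subseteq> K"
    "\<And>N. (\<Sum>i\<in>{..<N} \<times> {..<N}. (norm (measure_pmf.expectation (p N) (e i)))\<^sup>2) < 1 / Suc N"
    by blast
  have e_lim: "(\<lambda>N. measure_pmf.expectation (p N) (e i)) \<longlonglongrightarrow> 0" for i
  proof -
    have "(\<lambda>N. (norm (measure_pmf.expectation (p N) (e i)))\<^sup>2) \<longlonglongrightarrow> 0"
    proof (rule tendsto_sandwich[where f="\<lambda>_. 0"])
      show "\<forall>\<^sub>F N in sequentially. (norm (measure_pmf.expectation (p N) (e i)))\<^sup>2 \<le> 1 / Suc N"
        using eventually_gt_at_top[of "max (fst i) (snd i)"]
      proof eventually_elim
        case (elim N)
        then have "i \<in> {..<N} \<times> {..<N}" by (cases i) auto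
        then have "(norm (measure_pmf.expectation (p N) (e i)))\<^sup>2
            \<le> (\<Sum>i\<in>{..<N} \<times> {..<N}. (norm (measure_pmf.expectation (p N) (e i)))\<^sup>2)"
          by (intro member_le_sum) auto
        then show ?case using p(2)[of N] by linarith
      qed
      show "(\<lambda>N. 1 / real (Suc N)) \<longlonglongrightarrow> 0"
        using LIMSEQ_inverse_real_of_nat by (simp add: inverse_eq_divide)
    qed auto
    then have "(\<lambda>N. sqrt ((norm (measure_pmf.expectation (p N) (e i)))\<^sup>2)) \<longlonglongrightarrow> sqrt 0"
      by (rule tendsto_real_sqrt)
    then show ?thesis by (simp add: tendsto_norm_zero_iff)
  qed
  obtain r M where M: "strict_mono (r :: nat \<Rightarrow> nat)" "prob_space M" "sets M = sets borel" "emeasure M (- K) = 0"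
    and lim: "\<And>f :: complex \<times> complex \<Rightarrow> complex. continuous_on UNIV f \<Longrightarrow>
       (\<lambda>n. measure_pmf.expectation (p (r n)) f) \<longlonglongrightarrow> (\<integral>x. f x \<partial>M)"
    by (rule weak_limit_of_pmfs_on_torus[where p=p, OF K(1,2) p(1)]) (rule that)
  have e_int: "(\<integral>x. e i x \<partial>M) = 0" for i
  proof (rule LIMSEQ_unique)
    show "(\<lambda>n. measure_pmf.expectation (p (r n)) (e i)) \<longlonglongrightarrow> (\<integral>x. e i x \<partial>M)"
      unfolding e_def by (intro lim continuous_intros)
    show "(\<lambda>n. measure_pmf.expectation (p (r n)) (e i)) \<longlonglongrightarrow> 0"
      using LIMSEQ_subseq_LIMSEQ[OF e_lim M(1)] by (simp add: o_def)
  qed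
  \<comment> \<open>As an involution, \<open>Tmap\<close> carries \<open>K\<close> back to
    \<open>S\<close>. It conjugates the second coordinate, so the moments of \<open>M\<close> become
    the mixed moments of \<open>M'\<close>.\<close>
  define M' where "M' = distr M borel Tmap"
  have Tmap_meas [measurable]: "Tmap \<in> measurable M borel"
    unfolding measurable_cong_sets[OF M(3) refl] by (intro borel_measurable_continuous_onI continuous_on_Tmap)
  have "z \<in> K \<longleftrightarrow> Tmap z \<in> S" for z
    unfolding K_def by (metis Tmap_Tmap image_iff)
  then have "Tmap -` (- S) \<inter> space M = - K"
    using sets_eq_imp_space_eq[OF M(3)] by (simp add: set_eq_iff)
  then have null: "emeasure M' (- S) = 0"
    using S(2) M(4) by (simp add: M'_def emeasure_distr compact_imp_closed)
  have "prob_space M'" unfolding M'_def using M(2) by (rule prob_space.prob_space_distr) measurable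
  moreover have "emeasure M' (- torus2) = 0"
    using null S by (intro emeasure_eq_0[OF _ null]) (auto simp: M'_def compact_imp_closed)
  ultimately interpret torus_prob M'
    by (simp add: torus_prob_def torus_prob_axioms_def M'_def)
  have "(\<integral>\<zeta>. fst \<zeta> ^ Suc m * cnj (snd \<zeta>) ^ Suc n \<partial>M') = 0" for m n
  proof -
    have "(\<lambda>\<zeta>. fst \<zeta> ^ Suc m * cnj (snd \<zeta>) ^ Suc n) \<in> borel_measurable borel"
      by (intro borel_measurable_continuous_onI continuous_intros)
    then have "(\<integral>\<zeta>. fst \<zeta> ^ Suc m * cnj (snd \<zeta>) ^ Suc n \<partial>M') = (\<integral>z. e (m, n) z \<partial>M)"
      unfolding M'_def e_def by (subst integral_distr) (auto simp: Tmap_def)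
    then show ?thesis using e_int by simp
  qed
  then have "positive_RP_measure M'" by (rule positive_RP_measureI)
  from no_RP[OF this null] emeasure_space_1 show False by (simp add: M'_def)
qed

theorem mainTheorem14:
  fixes S :: "(complex \<times> complex) set"
  assumes "S \<subseteq> torus2" and "compact S"
    and "\<And>M. positive_RP_measure M \<Longrightarrow> emeasure M (- S) = 0 \<Longrightarrow> emeasure M UNIV = 0"
  shows "\<forall>g. continuous_on (Tmap ` S) g \<longrightarrow>
           (\<forall>\<epsilon>>0. \<exists>f\<in>bidisc_algebra0. \<forall>x\<in>Tmap ` S. norm (f x - g x) < \<epsilon>)"
proof (cases "S = {}")
  case True
  \<comment> \<open>Over the empty set any element of the ideal is a witness; the moment argument
    starts from a nonempty \<open>S\<close>.\<close>
  have "bidisc_algebra0 \<noteq> {}"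
    using bidisc_algebra_const unfolding bidisc_algebra0_def by blast
  with True show ?thesis by auto
next
  case False
  then obtain f where f: "f \<in> bidisc_algebra0" "\<And>x. x \<in> Tmap ` S \<Longrightarrow> 0 < Re (f x)"
    using exists_positive_real_part[OF assms(1,2) False assms(3)] by blast
  have "Tmap ` S \<subseteq> torus2" "compact (Tmap ` S)"
    using assms(1,2) by (auto intro!: Tmap_image_torus2 compact_continuous_image continuous_on_Tmap)
  from approximable_continuous[OF this f] show ?thesis
    unfolding approximable_def by blast
qed

end
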